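(* Let $X$ be a random variable with $\mathbb{E}X=0$ and $\mathrm{Var}(X)=1$, let $(X_n)_{n\ge 1}$ be independent copies of $X$, and suppose that the normalized sums $Z_n=\frac{1}{\sqrt n}(X_1+\dots+X_n)$ have densities $p_n$ for all large $n$. Suppose that for every $\alpha>0$ there is some $n=n_\alpha$ such that $D_\alpha(p_n\|\varphi)<\infty$. Then $D_\alpha(p_n\|\varphi)\to 0$ as $n\to\infty$ for every $\alpha>0$ if and only if $X$ is strictly subgaussian.
   Context: $\varphi(x)=\frac{1}{\sqrt{2\pi}}e^{-x^2/2}$ is the standard normal density. For $\alpha>0$, $\alpha\neq 1$, the Rényi divergence of order $\alpha$ of a density $p$ from $\varphi$ is $$D_\alpha(p\|\varphi)=\frac{1}{\alpha-1}\log\int_{-\infty}^{\infty}\Big(\frac{p(x)}{\varphi(x)}\Big)^{\alpha}\varphi(x)\,dx,$$ and $D_1(p\|\varphi)=\int p\log\frac{p}{\varphi}\,dx$ is the relative entropy (Kullback–Leibler distance). A random variable $X$ is called strictly subgaussian if $\mathbb{E}\,e^{tX}\le e^{\sigma^2t^2/2}$ for all $t\in\mathbb{R}$ with $\sigma^2=\mathrm{Var}(X)$. *)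

theory Defs
  imports "HOL-Probability.Probability"
begin

definition ln_ennreal :: "ennreal \<Rightarrow> ereal" where
  "ln_ennreal u =
     (if u = 0 then -\<infinity> else if u = \<infinity> then \<infinity> else ereal (ln (enn2real u)))"

text \<open>
  For a probability density \<open>p\<close>, the extended integral of \<open>p log (p / \<phi>)\<close> with \<open>\<phi>\<close> the standard
  normal density, as positive part minus negative part. The negative part has a finite integral,
  because \<open>u log u \<ge> - 1 / e\<close> for \<open>u \<ge> 0\<close>. The library's \<open>KL_divergence\<close> is real-valued and is \<open>0\<close>
  where the entropy density is not integrable, so it cannot express an infinite relative entropy.
  Points with \<open>p x = 0\<close> contribute \<open>0\<close>.
\<close>

definition relative_entropy_normal :: "(real \<Rightarrow> real) \<Rightarrow> ereal" where
  "relative_entropy_normal p =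
     enn2ereal (\<integral>\<^sup>+x. ennreal (p x * ln (p x / std_normal_density x)) \<partial>lborel)
     - enn2ereal (\<integral>\<^sup>+x. ennreal (- (p x * ln (p x / std_normal_density x))) \<partial>lborel)"

text \<open>Here \<open>p\<close> is a probability density with respect to Lebesgue measure and \<open>\<alpha> > 0\<close>.\<close>

definition renyi_divergence_normal :: "real \<Rightarrow> (real \<Rightarrow> real) \<Rightarrow> ereal" where
  "renyi_divergence_normal \<alpha> p =
     (if \<alpha> = 1 then relative_entropy_normal p
      else ereal (1 / (\<alpha> - 1)) *
        ln_ennreal (\<integral>\<^sup>+x. ennreal ((p x / std_normal_density x) powr \<alpha> * std_normal_density x)
          \<partial>lborel))"

definition has_density :: "'a measure \<Rightarrow> ('a \<Rightarrow> real) \<Rightarrow> (real \<Rightarrow> real) \<Rightarrow> bool" where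
  "has_density M Z p \<longleftrightarrow>
     p \<in> borel_measurable lborel \<and> (\<forall>x. 0 \<le> p x) \<and> distributed M lborel Z (\<lambda>x. ennreal (p x))"

text \<open>
  The moment generating function is a nonnegative integral, so that the bound includes its
  finiteness; a Bochner integral would be \<open>0\<close> where the exponential is not integrable.
\<close>

definition strictly_subgaussian :: "'a measure \<Rightarrow> ('a \<Rightarrow> real) \<Rightarrow> bool" where
  "strictly_subgaussian M X \<longleftrightarrow>
     X \<in> borel_measurable M \<and> integrable M (\<lambda>\<omega>. (X \<omega>)\<^sup>2) \<and>
     (\<forall>t. (\<integral>\<^sup>+\<omega>. ennreal (exp (t * X \<omega>)) \<partial>M)
            \<le> ennreal (exp (prob_space.variance M X * t\<^sup>2 / 2)))"

definition normalized_sum :: "(nat \<Rightarrow> 'a \<Rightarrow> real) \<Rightarrow> nat \<Rightarrow> 'a \<Rightarrow> real" where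
  "normalized_sum Xs n \<omega> = (\<Sum>i=1..n. Xs i \<omega>) / sqrt (real n)"

end

theory Submission
  imports Defs
begin

text \<open>
  Write \<open>u = p / \<phi>\<close> for a density \<open>p\<close> of the normalized sum \<open>Z\<^sub>n\<close>, and \<open>L\<close> for the moment generating
  function of \<open>X\<close>.
  
  Necessity. For conjugate exponents \<open>\<alpha>\<close>, \<open>\<beta>\<close>, Young's inequality bounds \<open>E exp (s Z\<^sub>n)\<close> by
  \<open>exp (\<beta> s\<^sup>2 / 2)\<close> times \<open>1 + \<integral> u powr \<alpha> \<phi>\<close>. If the divergences tend to \<open>0\<close>, the last factor stays bounded in
  \<open>n\<close>. With \<open>s = t sqrt n\<close> the left side is \<open>L(t) ^ n\<close>, so taking \<open>n\<close>-th roots removes the constant and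
  gives \<open>L(t) \<le> exp (\<beta> t\<^sup>2 / 2)\<close>. Then \<open>\<alpha> \<rightarrow> \<infinity>\<close>, that is \<open>\<beta> \<rightarrow> 1\<close>.
  
  Sufficiency. Every order \<open>\<alpha>\<close> follows by dominated convergence from two facts about the densities
  \<open>p\<^sub>n\<close>: they converge to \<open>\<phi>\<close> almost everywhere (\<open>density_tendsto_normal\<close>), and for each \<open>\<epsilon> > 0\<close> the ratios
  are eventually dominated by a multiple of \<open>exp (\<epsilon> x\<^sup>2)\<close> (\<open>density_domination\<close>). The domination comes from
  exponential tilting. The law of \<open>Z\<^sub>n\<close> tilted by \<open>h = y sqrt n\<close> has density
  \<open>exp (h x) p\<^sub>n(x) / L(y) ^ n\<close> and characteristic function \<open>f\<^sub>y(t / sqrt n) ^ n\<close>, where \<open>f\<^sub>y\<close> belongs to the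
  law of \<open>X\<close> tilted by \<open>y\<close>. Since \<open>L(y) ^ n \<le> exp (n y\<^sup>2 / 2)\<close>, Fourier inversion gives
  \<open>p\<^sub>n(x) \<le> exp (n y\<^sup>2 / 2 - y x sqrt n) sqrt n \<integral> |f\<^sub>y| ^ n\<close>,
  and the choice \<open>y = x / sqrt n\<close> turns the first factor into \<open>exp (- x\<^sup>2 / 2)\<close>. What remains is to
  control \<open>\<integral> |f\<^sub>y| ^ n\<close>.
  
  Finiteness of \<open>D\<^sub>2\<close> at one index \<open>n\<^sub>0\<close> says that \<open>p\<^sub>n\<^sub>0\<close> is square integrable against
  \<open>exp (x\<^sup>2 / 2)\<close>. Then all tilts of it are square integrable, and Parseval's inequality bounds
  \<open>\<integral> |f\<^sub>y| ^ (2 n\<^sub>0)\<close> by a multiple of \<open>exp (2 n\<^sub>0 y\<^sup>2)\<close>. The same bound for all \<open>n \<ge> 2 n\<^sub>0\<close> costs only a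
  factor \<open>sqrt n\<close>, which is harmless where \<open>|x| \<ge> sqrt n\<close>. In the range \<open>|x| < sqrt n\<close>, where
  \<open>|y| < 1\<close>, that factor has to be recovered: the integral bound, together with a uniform second moment bound, forces
  \<open>|f\<^sub>y(t)| \<le> 1 - c min 1 t\<^sup>2\<close> with one \<open>c > 0\<close> for all these \<open>y\<close> (\<open>uniform_char_gap\<close>), whence
  \<open>\<integral> |f\<^sub>y| ^ n = O(1 / sqrt n)\<close>. The case \<open>y = 0\<close> of this estimate also lets the central limit theorem
  be integrated into the pointwise convergence of the densities.
\<close>

section \<open>The modulus of a characteristic function\<close>

lemma abs_sin_of_nat_mult_le: "\<bar>sin (real k * a)\<bar> \<le> real k * \<bar>sin a\<bar>"
proof (induction k)
  case (Suc k)
  have "\<bar>sin (real (Suc k) * a)\<bar> = \<bar>sin a * cos (real k * a) + cos a * sin (real k * a)\<bar>"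
    by (simp add: algebra_simps sin_add)
  also have "\<dots> \<le> \<bar>sin a\<bar> * \<bar>cos (real k * a)\<bar> + \<bar>cos a\<bar> * \<bar>sin (real k * a)\<bar>"
    by (metis abs_mult abs_triangle_ineq)
  also have "\<dots> \<le> \<bar>sin a\<bar> * 1 + 1 * \<bar>sin (real k * a)\<bar>"
    by (intro add_mono mult_mono) auto
  finally show ?case using Suc by (simp add: algebra_simps)
qed simp

lemma one_minus_cos_of_nat_mult_le: "1 - cos (real k * u) \<le> (real k)\<^sup>2 * (1 - cos u)"
proof -
  have half: "1 - cos v = 2 * (sin (v / 2))\<^sup>2" for v :: real
    using cos_double_sin[of "v / 2"] by simp
  have "\<bar>sin (real k * (u / 2))\<bar>\<^sup>2 \<le> (real k * \<bar>sin (u / 2)\<bar>)\<^sup>2"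
    by (intro power_mono abs_sin_of_nat_mult_le) auto
  then show ?thesis
    unfolding half by (simp add: power_mult_distrib)
qed

lemma one_minus_cos_add_le: "1 - cos (u + v) \<le> 2 * (1 - cos u) + 2 * (1 - cos (v::real))"
proof -
  have half: "1 - cos v = 2 * (sin (v / 2))\<^sup>2" for v :: real
    using cos_double_sin[of "v / 2"] by simp
  have "\<bar>sin ((u + v) / 2)\<bar> = \<bar>sin (u/2) * cos (v/2) + cos (u/2) * sin (v/2)\<bar>"
    by (simp add: add_divide_distrib sin_add)
  also have "\<dots> \<le> \<bar>sin (u/2)\<bar> * \<bar>cos (v/2)\<bar> + \<bar>cos (u/2)\<bar> * \<bar>sin (v/2)\<bar>"
    by (metis abs_mult abs_triangle_ineq)
  also have "\<dots> \<le> \<bar>sin (u/2)\<bar> * 1 + 1 * \<bar>sin (v/2)\<bar>"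
    by (intro add_mono mult_mono) auto
  finally have "\<bar>sin ((u + v) / 2)\<bar>\<^sup>2 \<le> (\<bar>sin (u/2)\<bar> + \<bar>sin (v/2)\<bar>)\<^sup>2"
    by (intro power_mono) auto
  also have "\<dots> \<le> 2 * (sin (u/2))\<^sup>2 + 2 * (sin (v/2))\<^sup>2"
    using sum_squares_bound[of "\<bar>sin (u/2)\<bar>" "\<bar>sin (v/2)\<bar>"] by (simp add: power2_sum)
  finally show ?thesis
    unfolding half by simp
qed

context real_distribution
begin

lemma prob_UNIV [simp]: "prob UNIV = 1"
  using prob_space by simp

lemma integrable_cos [simp, intro]: "integrable M (\<lambda>x. cos (t * x - \<theta>))"
  by (rule integrable_const_bound[where B=1]) auto

lemma integral_cos_eq: "(\<integral>x. cos (t * x - \<theta>) \<partial>M) = Re (cis (- \<theta>) * char M t)"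
proof -
  have int: "integrable M (\<lambda>x. iexp (t * x))"
    by (rule integrable_iexp) auto
  have "cis (- \<theta>) * char M t = (CLINT x|M. cis (- \<theta>) * iexp (t * x))"
    unfolding char_def by simp
  also have "Re \<dots> = (\<integral>x. Re (cis (- \<theta>) * iexp (t * x)) \<partial>M)"
    using int by (intro integral_Re[symmetric]) auto
  also have "\<dots> = (\<integral>x. cos (t * x - \<theta>) \<partial>M)"
    by (intro Bochner_Integration.integral_cong refl)
       (simp add: cis_conv_exp flip: exp_add, simp add: Re_exp algebra_simps flip: of_real_mult)
  finally show ?thesis by simp
qed

lemma integral_cos_le_norm_char: "(\<integral>x. cos (t * x - \<theta>) \<partial>M) \<le> norm (char M t)"
  unfolding integral_cos_eq
  using complex_Re_le_cmod[of "cis (- \<theta>) * char M t"] by (simp add: norm_mult)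

lemma norm_char_eq_integral_cos: "\<exists>\<theta>. norm (char M t) = (\<integral>x. cos (t * x - \<theta>) \<partial>M)"
proof -
  have "cis (- Arg (char M t)) * char M t = of_real (norm (char M t))"
    by (metis (no_types, opaque_lifting) cis_cnj complex_norm_square mult.commute mult.left_commute 
     mult.right_neutral of_real_1 rcis_cmod_Arg rcis_def norm_cis power_one)
  then show ?thesis
    unfolding integral_cos_eq by (metis Re_complex_of_real)
qed

text \<open>
  Multiply by the phase that makes \<open>char M t\<close> real: then \<open>1 - |char M t|\<close> is the mean of
  \<open>1 - cos (t x - \<theta>) = 2 sin\<^sup>2 ((t x - \<theta>) / 2)\<close>, and \<open>|sin (k a)| \<le> k |sin a|\<close> applies pointwise. Any other phase
  only decreases the mean cosine, so the phase \<open>k \<theta>\<close> may be used at \<open>k t\<close>.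
\<close>

lemma one_minus_norm_char_mult_le:
  "1 - norm (char M (real k * t)) \<le> (real k)\<^sup>2 * (1 - norm (char M t))"
proof -
  obtain \<theta> where \<theta>: "norm (char M t) = (\<integral>x. cos (t * x - \<theta>) \<partial>M)"
    using norm_char_eq_integral_cos by blast
  have "1 - norm (char M (real k * t)) \<le> 1 - (\<integral>x. cos (real k * t * x - real k * \<theta>) \<partial>M)"
    using integral_cos_le_norm_char by simp
  also have "\<dots> = (\<integral>x. 1 - cos (real k * t * x - real k * \<theta>) \<partial>M)"
    by (simp add: prob_space)
  also have "\<dots> \<le> (\<integral>x. (real k)\<^sup>2 * (1 - cos (t * x - \<theta>)) \<partial>M)"
  proof (rule integral_mono)
    show "1 - cos (real k * t * x - real k * \<theta>) \<le> (real k)\<^sup>2 * (1 - cos (t * x - \<theta>))" for x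
      using one_minus_cos_of_nat_mult_le[of k "t * x - \<theta>"] by (simp add: algebra_simps)
  qed auto
  also have "\<dots> = (real k)\<^sup>2 * (1 - norm (char M t))"
    by (simp add: \<theta> prob_space)
  finally show ?thesis .
qed

text \<open>
  The same phases at \<open>s\<close> and \<open>t\<close> are added at \<open>s + t\<close>. So a modulus near \<open>1\<close> at \<open>s\<close> and at \<open>t\<close>
  persists at \<open>s + t\<close>.
\<close>

lemma one_minus_norm_char_add_le:
  "1 - norm (char M (s + t)) \<le> 2 * (1 - norm (char M s)) + 2 * (1 - norm (char M t))"
proof -
  obtain \<theta> where \<theta>: "norm (char M t) = (\<integral>x. cos (t * x - \<theta>) \<partial>M)"
    using norm_char_eq_integral_cos by blast
  obtain \<eta> where \<eta>: "norm (char M s) = (\<integral>x. cos (s * x - \<eta>) \<partial>M)"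
    using norm_char_eq_integral_cos by blast
  have "1 - norm (char M (s + t)) \<le> 1 - (\<integral>x. cos ((s + t) * x - (\<eta> + \<theta>)) \<partial>M)"
    using integral_cos_le_norm_char by simp
  also have "\<dots> = (\<integral>x. 1 - cos ((s + t) * x - (\<eta> + \<theta>)) \<partial>M)"
    by (simp add: prob_space)
  also have "\<dots> \<le> (\<integral>x. 2 * (1 - cos (s * x - \<eta>)) + 2 * (1 - cos (t * x - \<theta>)) \<partial>M)"
  proof (rule integral_mono)
    show "1 - cos ((s + t) * x - (\<eta> + \<theta>)) \<le> 2 * (1 - cos (s * x - \<eta>)) + 2 * (1 - cos (t * x - \<theta>))" for x
      using one_minus_cos_add_le[of "s * x - \<eta>" "t * x - \<theta>"] by (simp add: algebra_simps)
  qed auto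
  also have "\<dots> = 2 * (1 - norm (char M s)) + 2 * (1 - norm (char M t))"
    by (simp add: \<theta> \<eta> prob_space)
  finally show ?thesis .
qed

lemma one_minus_norm_char_le_second_moment:
  assumes "integrable M (\<lambda>x. x\<^sup>2)"
  shows "1 - norm (char M s) \<le> s\<^sup>2 / 2 * (\<integral>x. x\<^sup>2 \<partial>M)"
proof -
  have "1 - norm (char M s) \<le> 1 - (\<integral>x. cos (s * x - 0) \<partial>M)"
    using integral_cos_le_norm_char[of s 0] by simp
  also have "\<dots> = (\<integral>x. 1 - cos (s * x - 0) \<partial>M)"
    by (subst Bochner_Integration.integral_diff) (auto simp only: integrable_cos prob_space integrable_const, simp add: prob_space)
  also have "\<dots> \<le> (\<integral>x. s\<^sup>2 / 2 * x\<^sup>2 \<partial>M)"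
  proof (rule integral_mono)
    show "1 - cos (s * x - 0) \<le> s\<^sup>2 / 2 * x\<^sup>2" for x
    proof -
      have "1 - cos (s * x) = 2 * (sin (s * x / 2))\<^sup>2"
        using cos_double_sin[of "s * x / 2"] by simp
      also have "\<dots> \<le> 2 * (s * x / 2)\<^sup>2"
        using abs_sin_x_le_abs_x[of "s * x / 2"] by (simp only: abs_le_square_iff)
      finally show ?thesis by (simp add: power2_eq_square)
    qed
  qed (use assms integrable_cos[of s 0] in auto)
  finally show ?thesis by simp
qed

end

text \<open>
  If \<open>|f(t)|\<close> were too close to \<open>1\<close> at some \<open>|t| \<ge> 1\<close>, it would stay above \<open>1/2\<close> near each of the points
  \<open>0, t, 2 t, \<dots>, (K - 1) t\<close>, on intervals whose length depends only on the second moment. These are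
  disjoint, and \<open>K\<close> of them exceed the integral bound \<open>J\<close>. A point \<open>|t| < 1\<close> is moved beyond \<open>1\<close> by a
  multiple \<open>k \<approx> 1 / |t|\<close>, which costs the factor \<open>k\<^sup>2\<close> and leaves \<open>t\<^sup>2\<close>. The constant does not depend on
  the measure: this makes it usable for a whole family of tilted laws at once.
\<close>

lemma uniform_char_gap:
  fixes B J :: real and m :: nat
  assumes "B \<ge> 0" and "J \<ge> 0"
  shows "\<exists>c>0. \<forall>M. real_distribution M \<longrightarrow> integrable M (\<lambda>x. x\<^sup>2) \<longrightarrow> (\<integral>x. x\<^sup>2 \<partial>M) \<le> B \<longrightarrow>
           (\<integral>\<^sup>+t. ennreal (norm (char M t) ^ m) \<partial>lborel) \<le> ennreal J \<longrightarrow>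
           (\<forall>t. norm (char M t) \<le> 1 - c * min 1 (t\<^sup>2))"
proof -
  \<comment> \<open>The radius makes the intervals disjoint and keeps \<open>1 - |f(s)| \<le> 1/8\<close> for \<open>|s| \<le> s0\<close>.\<close>
  define s0 where "s0 = 1 / (4 * (1 + B))"
  have s0: "s0 > 0" "s0 \<le> 1/4"
    using assms by (auto simp: s0_def field_simps)
  have s0B: "s0\<^sup>2 * B \<le> 1/4"
  proof -
    have "s0 * B \<le> 1" using assms by (simp add: s0_def field_simps)
    then have "s0 * (s0 * B) \<le> 1/4 * 1" using s0 assms by (intro mult_mono) auto
    then show ?thesis by (simp add: power2_eq_square mult.assoc)
  qed
  obtain K where K: "real K * (2 * s0 * (1/2)^m) > J"
    using reals_Archimedean3[of "2 * s0 * (1/2)^m"] s0 by auto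
  then have K0: "K > 0" using assms by (cases K) auto
  \<comment> \<open>With this \<open>\<eta>\<close>, going up to \<open>K\<close> multiples loses at most \<open>K\<^sup>2 \<eta> = 1/8\<close>.\<close>
  define \<eta> where "\<eta> = 1 / (8 * (real K)\<^sup>2)"
  have \<eta>: "\<eta> > 0" using K0 by (simp add: \<eta>_def)
  have "norm (char M t) \<le> 1 - \<eta>/4 * min 1 (t\<^sup>2)"
    if M: "real_distribution M" and sq: "integrable M (\<lambda>x. x\<^sup>2)" "(\<integral>x. x\<^sup>2 \<partial>M) \<le> B"
      and Jb: "(\<integral>\<^sup>+t. ennreal (norm (char M t) ^ m) \<partial>lborel) \<le> ennreal J" for M t
  proof -
    interpret real_distribution M by fact
    have far: "1 - norm (char M t) > \<eta>" if t: "\<bar>t\<bar> \<ge> 1" for t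
    proof (rule ccontr)
      assume "\<not> ?thesis"
      then have le: "1 - norm (char M t) \<le> \<eta>" by simp
      define A where "A k = {real k * t - s0 .. real k * t + s0}" for k :: nat
      have big: "norm (char M x) \<ge> 1/2" if "k < K" "x \<in> A k" for k x
      proof -
        define s where "s = x - real k * t"
        have s: "\<bar>s\<bar> \<le> s0" using that by (auto simp: A_def s_def abs_le_iff)
        have "s\<^sup>2 / 2 * (\<integral>x. x\<^sup>2 \<partial>M) \<le> s0\<^sup>2 / 2 * B"
          using s sq s0 assms abs_le_square_iff[of s s0] by (intro mult_mono) auto
        then have "1 - norm (char M s) \<le> 1/8"
          using one_minus_norm_char_le_second_moment[OF sq(1), of s] s0B by simp
        moreover have "1 - norm (char M (real k * t)) \<le> 1/8"
        proof -
          have "1 - norm (char M (real k * t)) \<le> (real k)\<^sup>2 * (1 - norm (char M t))"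
            by (rule one_minus_norm_char_mult_le)
          also have "\<dots> \<le> (real K)\<^sup>2 * \<eta>"
            using le that cmod_char_le_1[of t] by (intro mult_mono power_mono) auto
          also have "\<dots> = 1/8" using K0 by (simp add: \<eta>_def)
          finally show ?thesis .
        qed
        moreover have "1 - norm (char M x) \<le> 2 * (1 - norm (char M (real k * t))) + 2 * (1 - norm (char M s))"
          using one_minus_norm_char_add_le[of "real k * t" s] by (simp add: s_def)
        ultimately show ?thesis by simp
      qed
      have disj: "disjoint_family_on A {..<K}"
        unfolding disjoint_family_on_def
      proof (intro ballI impI)
        fix i j assume ij: "i \<in> {..<K}" "j \<in> {..<K}" "i \<noteq> j"
        have "1 * 1 \<le> \<bar>real i - real j\<bar> * \<bar>t\<bar>"
          using ij t by (intro mult_mono) auto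
        then have "\<bar>real i * t - real j * t\<bar> \<ge> 1"
          by (simp add: abs_mult left_diff_distrib[symmetric])
        with s0 show "A i \<inter> A j = {}" by (auto simp: A_def)
      qed
      have "ennreal (real K * (2 * s0 * (1/2)^m)) = (\<Sum>k<K. ennreal (2 * s0) * ennreal ((1/2)^m))"
        using s0 by (simp add: ennreal_mult ennreal_of_nat_eq_real_of_nat mult.assoc)
      also have "\<dots> = (\<Sum>k<K. \<integral>\<^sup>+x. ennreal ((1/2)^m) * indicator (A k) x \<partial>lborel)"
        using s0 by (intro sum.cong refl) (simp add: A_def nn_integral_cmult_indicator mult.commute)
      also have "\<dots> = (\<integral>\<^sup>+x. (\<Sum>k<K. ennreal ((1/2)^m) * indicator (A k) x) \<partial>lborel)"
        by (rule nn_integral_sum[symmetric]) (simp add: A_def)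
      also have "\<dots> \<le> (\<integral>\<^sup>+x. ennreal (norm (char M x) ^ m) \<partial>lborel)"
      proof (rule nn_integral_mono)
        fix x
        have "(\<Sum>k<K. ennreal ((1/2)^m) * indicator (A k) x) = ennreal ((1/2)^m) * indicator (\<Union>k<K. A k) x"
          unfolding sum_distrib_left[symmetric] by (subst indicator_UN_disjoint[OF _ disj]) auto
        also have "\<dots> \<le> ennreal (norm (char M x) ^ m)"
          using big by (auto simp: indicator_def intro!: ennreal_leI power_mono)
        finally show "(\<Sum>k<K. ennreal ((1/2)^m) * indicator (A k) x) \<le> ennreal (norm (char M x) ^ m)" .
      qed
      also note Jb
      finally show False using K assms s0 by (simp add: ennreal_le_iff)
    qed
    consider "t = 0" | "\<bar>t\<bar> \<ge> 1" | "t \<noteq> 0" "\<bar>t\<bar> < 1" by linarith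
    then show ?thesis
    proof cases
      case 1 then show ?thesis by (simp add: char_zero)
    next
      case 2
      then have "min 1 (t\<^sup>2) = 1"
        using abs_le_square_iff[of 1 t] by simp
      then show ?thesis using far[OF 2] \<eta> by simp
    next
      case 3
      define k where "k = nat \<lceil>1 / \<bar>t\<bar>\<rceil>"
      have inv: "1 / \<bar>t\<bar> > 1" using 3 by simp
      have k: "1 / \<bar>t\<bar> \<le> real k" "real k \<le> 2 / \<bar>t\<bar>"
      proof -
        show "1 / \<bar>t\<bar> \<le> real k" unfolding k_def by linarith
        have "real k \<le> 1 / \<bar>t\<bar> + 1" unfolding k_def using inv by linarith
        also have "\<dots> \<le> 2 / \<bar>t\<bar>" using inv by simp
        finally show "real k \<le> 2 / \<bar>t\<bar>" .
      qed
      have kpos: "k > 0" using k(1) inv by (cases k) auto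
      have "\<bar>real k * t\<bar> \<ge> 1" using k(1) 3 by (simp add: field_simps abs_mult)
      from far[OF this] have "\<eta> < 1 - norm (char M (real k * t))" .
      also have "\<dots> \<le> (real k)\<^sup>2 * (1 - norm (char M t))" by (rule one_minus_norm_char_mult_le)
      also have "\<dots> \<le> (2 / \<bar>t\<bar>)\<^sup>2 * (1 - norm (char M t))"
        using k cmod_char_le_1[of t] by (intro mult_right_mono power_mono) auto
      also have "\<dots> = 4 / t\<^sup>2 * (1 - norm (char M t))" by (simp add: power_divide)
      finally have "\<eta> / 4 * t\<^sup>2 \<le> 1 - norm (char M t)"
        using 3 by (simp add: field_simps)
      moreover have "min 1 (t\<^sup>2) = t\<^sup>2"
        using abs_square_le_1[of t] 3 by auto
      ultimately show ?thesis by simp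
    qed
  qed
  then show ?thesis using \<eta> by (intro exI[of _ "\<eta>/4"]) auto
qed

text \<open>
  Near the origin the gap produces Gaussian decay of the \<open>n\<close>-th power. Away from it, \<open>n - k\<close> factors
  are exponentially small, and the other \<open>k\<close> are kept for integrability.
\<close>

lemma power_le_gauss_plus_tail:
  fixes g c t :: real
  assumes g: "0 \<le> g" "g \<le> 1" "g \<le> 1 - c * min 1 (t\<^sup>2)" and "c > 0" and "k \<le> n"
  shows "g ^ n \<le> exp (- (c * real n * t\<^sup>2)) + exp (- (c * real (n - k))) * g ^ k"
proof -
  have e: "g ^ m \<le> exp (- (real m * (c * min 1 (t\<^sup>2))))" for m
  proof -
    have "g \<le> exp (- (c * min 1 (t\<^sup>2)))"
      using g(3) exp_ge_add_one_self[of "- (c * min 1 (t\<^sup>2))"] by linarith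
    then have "g ^ m \<le> exp (- (c * min 1 (t\<^sup>2))) ^ m" using g by (intro power_mono) auto
    also have "\<dots> = exp (- (real m * (c * min 1 (t\<^sup>2))))" by (simp flip: exp_of_nat_mult)
    finally show ?thesis .
  qed
  show ?thesis
  proof (cases "t\<^sup>2 \<le> 1")
    case True
    then have "g ^ n \<le> exp (- (c * real n * t\<^sup>2))" using e[of n] by (simp add: ac_simps)
    moreover have "0 \<le> exp (- (c * real (n - k))) * g ^ k" using g by simp
    ultimately show ?thesis by linarith
  next
    case False
    have "g ^ n = g ^ (n - k) * g ^ k" using assms by (simp flip: power_add)
    also have "\<dots> \<le> exp (- (c * real (n - k))) * g ^ k"
      using e[of "n - k"] False g by (intro mult_right_mono) (auto simp: ac_simps)
    finally show ?thesis by (smt (verit) exp_gt_zero)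
  qed
qed

section \<open>Parseval's inequality\<close>

text \<open>
  Averaging \<open>|char M t|\<^sup>2\<close> over \<open>t\<close> with a probability measure \<open>N\<close> keeps all the Fubini steps within
  bounded functions on probability spaces.
\<close>

lemma integral_norm_char_squared_eq:
  assumes M: "real_distribution M" and N: "real_distribution N"
  shows "(\<integral>t. (norm (char M t))\<^sup>2 \<partial>N) = (\<integral>y. (\<integral>x. Re (char N (x - y)) \<partial>M) \<partial>M)"
proof -
  interpret M: real_distribution M by fact
  interpret N: real_distribution N by fact
  interpret NM: pair_prob_space N M ..
  have [measurable]: "char M \<in> borel_measurable borel" "char N \<in> borel_measurable borel" by auto
  have inner: "(\<integral>t. iexp (- (t * y)) * char M t \<partial>N) = (\<integral>x. char N (x - y) \<partial>M)" for y
  proof -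
    have "(\<integral>t. iexp (- (t * y)) * char M t \<partial>N) = (\<integral>t. (\<integral>x. iexp (- (t * y)) * iexp (t * x) \<partial>M) \<partial>N)"
      unfolding char_def by simp
    also have "\<dots> = (\<integral>t. (\<integral>x. iexp (t * (x - y)) \<partial>M) \<partial>N)"
      by (intro Bochner_Integration.integral_cong refl) (simp add: algebra_simps flip: exp_add)
    also have "\<dots> = (\<integral>x. (\<integral>t. iexp (t * (x - y)) \<partial>N) \<partial>M)"
      by (rule NM.Fubini_integral[symmetric]) (auto intro!: NM.P.integrable_const_bound[where B=1] simp del: of_real_mult of_real_diff)
    also have "\<dots> = (\<integral>x. char N (x - y) \<partial>M)"
      unfolding char_def by (simp add: mult.commute)
    finally show ?thesis .
  qed
  have "complex_of_real (\<integral>t. (norm (char M t))\<^sup>2 \<partial>N) = (\<integral>t. of_real ((norm (char M t))\<^sup>2) \<partial>N)"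
    by (rule integral_complex_of_real[symmetric])
  also have "\<dots> = (\<integral>t. (\<integral>y. iexp (- (t * y)) * char M t \<partial>M) \<partial>N)"
  proof (intro Bochner_Integration.integral_cong refl)
    fix t
    have "cnj (char M t) = (\<integral>y. cnj (iexp (t * y)) \<partial>M)"
      unfolding char_def by simp
    also have "\<dots> = (\<integral>y. iexp (- (t * y)) \<partial>M)"
      by (simp add: exp_cnj)
    finally show "complex_of_real ((norm (char M t))\<^sup>2) = (\<integral>y. iexp (- (t * y)) * char M t \<partial>M)"
      by (simp add: complex_norm_square mult.commute del: of_real_power of_real_minus of_real_mult)
  qed
  also have "\<dots> = (\<integral>y. (\<integral>t. iexp (- (t * y)) * char M t \<partial>N) \<partial>M)"
    by (rule NM.Fubini_integral[symmetric])
       (auto intro!: NM.P.integrable_const_bound[where B=1] simp: norm_mult M.cmod_char_le_1 simp del: of_real_mult of_real_minus)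
  also have "\<dots> = (\<integral>y. (\<integral>x. char N (x - y) \<partial>M) \<partial>M)"
    unfolding inner ..
  finally have "(\<integral>t. (norm (char M t))\<^sup>2 \<partial>N) = Re (\<integral>y. (\<integral>x. char N (x - y) \<partial>M) \<partial>M)"
    by (metis Re_complex_of_real)
  also have "\<dots> = (\<integral>y. Re (\<integral>x. char N (x - y) \<partial>M) \<partial>M)"
  proof (rule integral_Re[symmetric], rule M.integrable_const_bound[where B=1])
    show "AE y in M. norm (\<integral>x. char N (x - y) \<partial>M) \<le> 1"
    proof (rule AE_I2)
      fix y
      have "norm (\<integral>x. char N (x - y) \<partial>M) \<le> (\<integral>x. norm (char N (x - y)) \<partial>M)"
        by (rule integral_norm_bound)
      also have "\<dots> \<le> (\<integral>x. 1 \<partial>M)"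
        by (rule integral_mono) (auto intro!: M.integrable_const_bound[where B=1] simp: N.cmod_char_le_1)
      finally show "norm (\<integral>x. char N (x - y) \<partial>M) \<le> 1" using M.prob_space by simp
    qed
  qed measurable
  also have "\<dots> = (\<integral>y. (\<integral>x. Re (char N (x - y)) \<partial>M) \<partial>M)"
    by (intro Bochner_Integration.integral_cong refl integral_Re[symmetric] M.integrable_const_bound[where B=1])
       (auto simp: N.cmod_char_le_1)
  finally show ?thesis .
qed

lemma char_centered_normal:
  assumes "\<sigma> > 0"
  shows "char (density lborel (normal_density 0 \<sigma>)) z = of_real (exp (- (\<sigma> * z)\<^sup>2 / 2))"
proof -
  have "char (density lborel (normal_density 0 \<sigma>)) z = (\<integral>x. normal_density 0 \<sigma> x *\<^sub>R iexp (z * x) \<partial>lborel)"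
    unfolding char_def by (intro integral_density) auto
  also have "\<dots> = \<bar>\<sigma>\<bar> *\<^sub>R (\<integral>x. normal_density 0 \<sigma> (0 + \<sigma> * x) *\<^sub>R iexp (z * (0 + \<sigma> * x)) \<partial>lborel)"
    using assms by (intro lborel_integral_real_affine) auto
  also have "\<dots> = (\<integral>x. std_normal_density x *\<^sub>R iexp ((\<sigma> * z) * x) \<partial>lborel)"
    unfolding integral_scaleR_right[symmetric]
    using assms by (intro Bochner_Integration.integral_cong refl)
      (simp add: normal_density_def real_sqrt_mult power_mult_distrib scaleR_conv_of_real ac_simps)
  also have "\<dots> = char std_normal_distribution (\<sigma> * z)"
    unfolding char_def by (intro integral_density[symmetric]) auto
  finally show ?thesis by (simp add: char_std_normal_distribution)
qed

lemma real_distribution_normal: "\<sigma> > 0 \<Longrightarrow> real_distribution (density lborel (normal_density \<mu> \<sigma>))"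
  by (simp add: real_distribution_def real_distribution_axioms_def prob_space_normal_density)

lemma nn_integral_gauss_kernel:
  assumes "\<sigma> > 0"
  shows "(\<integral>\<^sup>+y. ennreal (exp (- (\<sigma> * (x - y))\<^sup>2 / 2)) \<partial>lborel) = ennreal (sqrt (2 * pi) / \<sigma>)"
proof -
  have "(\<integral>\<^sup>+y. ennreal (exp (- (\<sigma> * (x - y))\<^sup>2 / 2)) \<partial>lborel)
      = (\<integral>\<^sup>+y. ennreal (sqrt (2 * pi) / \<sigma>) * ennreal (normal_density x (1 / \<sigma>) y) \<partial>lborel)"
    using assms by (intro nn_integral_cong)
      (simp add: normal_density_def real_sqrt_mult real_sqrt_divide power2_commute power_mult_distrib power_divide flip: ennreal_mult)
  also have "\<dots> = ennreal (sqrt (2 * pi) / \<sigma>) * (\<integral>\<^sup>+y. ennreal (normal_density x (1 / \<sigma>) y) \<partial>lborel)"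
    by (rule nn_integral_cmult) auto
  also have "(\<integral>\<^sup>+y. ennreal (normal_density x (1 / \<sigma>) y) \<partial>lborel) = 1"
    using assms by (subst nn_integral_eq_integral) auto
  finally show ?thesis by simp
qed

lemma nn_integral_exp_neg_square:
  assumes "a > 0"
  shows "(\<integral>\<^sup>+t. ennreal (exp (- (a * t\<^sup>2))) \<partial>lborel) = ennreal (sqrt (pi / a))"
proof -
  have "(\<integral>\<^sup>+t. ennreal (exp (- (a * t\<^sup>2))) \<partial>lborel) = (\<integral>\<^sup>+t. ennreal (exp (- (sqrt (2 * a) * (0 - t))\<^sup>2 / 2)) \<partial>lborel)"
    using assms by (simp add: power_mult_distrib)
  also have "\<dots> = ennreal (sqrt (2 * pi) / sqrt (2 * a))"
    using assms by (intro nn_integral_gauss_kernel) simp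
  also have "sqrt (2 * pi) / sqrt (2 * a) = sqrt (pi / a)"
    using assms by (simp add: real_sqrt_divide[symmetric])
  finally show ?thesis .
qed

text \<open>
  Damping by a centered normal law of scale \<open>\<sigma>\<close> turns the left side into a double integral of
  \<open>p x p y\<close> against a Gaussian kernel of mass \<open>sqrt (2 \<pi>) / \<sigma>\<close>. The inequality
  \<open>p x p y \<le> (p x\<^sup>2 + p y\<^sup>2) / 2\<close> separates the variables, and \<open>\<sigma> \<rightarrow> \<infinity>\<close> removes the damping by monotone
  convergence.
\<close>

lemma nn_integral_norm_char_squared_le:
  fixes p :: "real \<Rightarrow> real"
  assumes p[measurable]: "p \<in> borel_measurable borel" and nn: "\<And>x. 0 \<le> p x"
    and D: "real_distribution (density lborel (\<lambda>x. ennreal (p x)))"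
  shows "(\<integral>\<^sup>+t. ennreal ((norm (char (density lborel (\<lambda>x. ennreal (p x))) t))\<^sup>2) \<partial>lborel)
       \<le> ennreal (2 * pi) * (\<integral>\<^sup>+x. ennreal ((p x)\<^sup>2) \<partial>lborel)"
proof -
  define M where "M = density lborel (\<lambda>x. ennreal (p x))"
  interpret M: real_distribution M using D by (simp add: M_def)
  interpret MM: pair_prob_space M M ..
  have [measurable]: "char M \<in> borel_measurable borel" by auto
  have damped: "(\<integral>\<^sup>+t. ennreal ((norm (char M t))\<^sup>2) * ennreal (exp (- (t / \<sigma>)\<^sup>2 / 2)) \<partial>lborel)
       \<le> ennreal (2 * pi) * (\<integral>\<^sup>+x. ennreal ((p x)\<^sup>2) \<partial>lborel)" if \<sigma>: "\<sigma> > 0" for \<sigma> :: real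
  proof -
    define N where "N = density lborel (\<lambda>x. ennreal (normal_density 0 \<sigma> x))"
    have N: "real_distribution N" using real_distribution_normal[OF \<sigma>] by (simp add: N_def)
    interpret N: real_distribution N by fact
    let ?k = "\<lambda>x y. exp (- (\<sigma> * (x - y))\<^sup>2 / 2)"
    have k1: "?k x y \<le> 1" for x y by simp
    have "(\<integral>\<^sup>+t. ennreal ((norm (char M t))\<^sup>2) \<partial>N) = ennreal (\<integral>t. (norm (char M t))\<^sup>2 \<partial>N)"
      by (intro nn_integral_eq_integral N.integrable_const_bound[where B=1])
         (auto simp: power_le_one M.cmod_char_le_1)
    also have "\<dots> = ennreal (\<integral>y. (\<integral>x. ?k x y \<partial>M) \<partial>M)"
      unfolding integral_norm_char_squared_eq[OF M.real_distribution_axioms N]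
      using char_centered_normal[OF \<sigma>] by (simp add: N_def)
    also have "\<dots> = (\<integral>\<^sup>+y. ennreal (\<integral>x. ?k x y \<partial>M) \<partial>M)"
    proof (intro nn_integral_eq_integral[symmetric] M.integrable_const_bound[where B=1] AE_I2)
      fix y
      have "(\<integral>x. ?k x y \<partial>M) \<le> (\<integral>x. 1 \<partial>M)"
        by (rule integral_mono) (auto intro!: M.integrable_const_bound[where B=1])
      moreover have "0 \<le> (\<integral>x. ?k x y \<partial>M)" by simp
      ultimately show "norm (\<integral>x. ?k x y \<partial>M) \<le> 1" using M.prob_space by simp
    qed auto
    also have "\<dots> = (\<integral>\<^sup>+y. (\<integral>\<^sup>+x. ennreal (?k x y) \<partial>M) \<partial>M)"
      by (intro nn_integral_cong nn_integral_eq_integral[symmetric] M.integrable_const_bound[where B=1]) auto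
    also have "\<dots> = (\<integral>\<^sup>+y. (\<integral>\<^sup>+x. ennreal (p y) * (ennreal (p x) * ennreal (?k x y)) \<partial>lborel) \<partial>lborel)"
      by (simp add: M_def nn_integral_density nn_integral_cmult)
    also have "\<dots> \<le> (\<integral>\<^sup>+y. (\<integral>\<^sup>+x. ennreal ((p y)\<^sup>2 / 2) * ennreal (?k x y) + ennreal ((p x)\<^sup>2 / 2) * ennreal (?k x y) \<partial>lborel) \<partial>lborel)"
    proof (intro nn_integral_mono)
      fix x y
      have "p y * (p x * ?k x y) = (p x * p y) * ?k x y" by simp
      also have "\<dots> \<le> ((p y)\<^sup>2 / 2 + (p x)\<^sup>2 / 2) * ?k x y"
        using sum_squares_bound[of "p x" "p y"] by (intro mult_right_mono) auto
      finally show "ennreal (p y) * (ennreal (p x) * ennreal (?k x y))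
          \<le> ennreal ((p y)\<^sup>2 / 2) * ennreal (?k x y) + ennreal ((p x)\<^sup>2 / 2) * ennreal (?k x y)"
        using nn by (simp add: algebra_simps flip: ennreal_mult ennreal_plus)
    qed
    also have "\<dots> = (\<integral>\<^sup>+y. (\<integral>\<^sup>+x. ennreal ((p y)\<^sup>2 / 2) * ennreal (?k x y) \<partial>lborel) \<partial>lborel)
                 + (\<integral>\<^sup>+y. (\<integral>\<^sup>+x. ennreal ((p x)\<^sup>2 / 2) * ennreal (?k x y) \<partial>lborel) \<partial>lborel)"
      by (simp add: nn_integral_add)
    also have "(\<integral>\<^sup>+y. (\<integral>\<^sup>+x. ennreal ((p x)\<^sup>2 / 2) * ennreal (?k x y) \<partial>lborel) \<partial>lborel)
        = (\<integral>\<^sup>+x. (\<integral>\<^sup>+y. ennreal ((p x)\<^sup>2 / 2) * ennreal (?k x y) \<partial>lborel) \<partial>lborel)"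
      by (rule lborel_pair.Fubini') simp
    also have "\<dots> = (\<integral>\<^sup>+x. ennreal ((p x)\<^sup>2 / 2) * ennreal (sqrt (2 * pi) / \<sigma>) \<partial>lborel)"
      by (intro nn_integral_cong, subst nn_integral_cmult, measurable) (simp only: nn_integral_gauss_kernel[OF \<sigma>])
    also have "(\<integral>\<^sup>+y. (\<integral>\<^sup>+x. ennreal ((p y)\<^sup>2 / 2) * ennreal (?k x y) \<partial>lborel) \<partial>lborel)
         = (\<integral>\<^sup>+x. ennreal ((p x)\<^sup>2 / 2) * ennreal (sqrt (2 * pi) / \<sigma>) \<partial>lborel)"
    proof -
      have "(\<integral>\<^sup>+x. ennreal (?k x y) \<partial>lborel) = ennreal (sqrt (2 * pi) / \<sigma>)" for y
      proof -
        have "(\<integral>\<^sup>+x. ennreal (?k x y) \<partial>lborel) = (\<integral>\<^sup>+x. ennreal (?k y x) \<partial>lborel)"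
          by (simp add: power_mult_distrib power2_commute)
        then show ?thesis using nn_integral_gauss_kernel[OF \<sigma>] by simp
      qed
      then show ?thesis by (simp add: nn_integral_cmult)
    qed
    also have "(\<integral>\<^sup>+x. ennreal ((p x)\<^sup>2 / 2) * ennreal (sqrt (2 * pi) / \<sigma>) \<partial>lborel) + (\<integral>\<^sup>+x. ennreal ((p x)\<^sup>2 / 2) * ennreal (sqrt (2 * pi) / \<sigma>) \<partial>lborel)
       = (\<integral>\<^sup>+x. ennreal (sqrt (2 * pi) / \<sigma>) * ennreal ((p x)\<^sup>2) \<partial>lborel)"
    proof -
      have half: "ennreal (u / 2) * ennreal c + ennreal (u / 2) * ennreal c = ennreal c * ennreal u"
        if "u \<ge> 0" "c \<ge> 0" for u c :: real
      proof -
        have "ennreal (u / 2) * ennreal c + ennreal (u / 2) * ennreal c = ennreal (u / 2 * c + u / 2 * c)"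
          using that by (simp only: ennreal_mult[symmetric] ennreal_plus[symmetric] mult_nonneg_nonneg divide_nonneg_nonneg zero_le_numeral)
        also have "u / 2 * c + u / 2 * c = c * u" by simp
        finally show ?thesis using that by (simp only: ennreal_mult)
      qed
      show ?thesis
        using \<sigma> by (subst nn_integral_add[symmetric], measurable) (intro nn_integral_cong half; simp)
    qed
    also have "\<dots> = ennreal (sqrt (2 * pi) / \<sigma>) * (\<integral>\<^sup>+x. ennreal ((p x)\<^sup>2) \<partial>lborel)"
      by (rule nn_integral_cmult) simp
    finally have main: "(\<integral>\<^sup>+t. ennreal ((norm (char M t))\<^sup>2) \<partial>N)
        \<le> ennreal (sqrt (2 * pi) / \<sigma>) * (\<integral>\<^sup>+x. ennreal ((p x)\<^sup>2) \<partial>lborel)" .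
    have "(\<integral>\<^sup>+t. ennreal ((norm (char M t))\<^sup>2) * ennreal (exp (- (t / \<sigma>)\<^sup>2 / 2)) \<partial>lborel)
       = (\<integral>\<^sup>+t. ennreal (sqrt (2 * pi) * \<sigma>) * (ennreal (normal_density 0 \<sigma> t) * ennreal ((norm (char M t))\<^sup>2)) \<partial>lborel)"
      using \<sigma> by (intro nn_integral_cong)
       (simp add: normal_density_def real_sqrt_mult power_divide ac_simps flip: ennreal_mult)
    also have "\<dots> = ennreal (sqrt (2 * pi) * \<sigma>) * (\<integral>\<^sup>+t. ennreal ((norm (char M t))\<^sup>2) \<partial>N)"
      by (simp add: N_def nn_integral_density nn_integral_cmult)
    also have "\<dots> \<le> ennreal (sqrt (2 * pi) * \<sigma>) * (ennreal (sqrt (2 * pi) / \<sigma>) * (\<integral>\<^sup>+x. ennreal ((p x)\<^sup>2) \<partial>lborel))"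
      by (intro mult_left_mono main) simp
    also have "\<dots> = ennreal (2 * pi) * (\<integral>\<^sup>+x. ennreal ((p x)\<^sup>2) \<partial>lborel)"
      using \<sigma> by (simp add: mult.assoc[symmetric] flip: ennreal_mult)
    finally show ?thesis .
  qed
  have "(\<lambda>n. \<integral>\<^sup>+t. ennreal ((norm (char M t))\<^sup>2) * ennreal (exp (- (t / real (Suc n))\<^sup>2 / 2)) \<partial>lborel)
     \<longlonglongrightarrow> (\<integral>\<^sup>+t. ennreal ((norm (char M t))\<^sup>2) \<partial>lborel)"
  proof (rule nn_integral_LIMSEQ)
    show "incseq (\<lambda>n t. ennreal ((norm (char M t))\<^sup>2) * ennreal (exp (- (t / real (Suc n))\<^sup>2 / 2)))"
    proof (rule incseq_SucI, rule le_funI, intro mult_left_mono ennreal_leI)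
      fix n t
      have "(t / real (Suc (Suc n)))\<^sup>2 \<le> (t / real (Suc n))\<^sup>2"
        unfolding power_divide by (intro divide_left_mono power_mono) auto
      then show "exp (- (t / real (Suc n))\<^sup>2 / 2) \<le> exp (- (t / real (Suc (Suc n)))\<^sup>2 / 2)"
        by simp
    qed simp
    fix t
    have "(\<lambda>n. t / real (Suc n)) \<longlonglongrightarrow> 0"
      by (rule LIMSEQ_Suc[OF lim_const_over_n])
    then have "(\<lambda>n. (norm (char M t))\<^sup>2 * exp (- (t / real (Suc n))\<^sup>2 / 2)) \<longlonglongrightarrow> (norm (char M t))\<^sup>2 * exp (- 0\<^sup>2 / 2)"
      by (intro tendsto_mult tendsto_const tendsto_exp tendsto_divide tendsto_minus tendsto_power) auto
    from tendsto_ennrealI[OF this]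
    show "(\<lambda>n. ennreal ((norm (char M t))\<^sup>2) * ennreal (exp (- (t / real (Suc n))\<^sup>2 / 2))) \<longlonglongrightarrow> ennreal ((norm (char M t))\<^sup>2)"
      by (simp only: ennreal_mult[symmetric] zero_le_power2 exp_ge_zero) simp
  qed auto
  then show ?thesis
    unfolding M_def[symmetric] by (rule LIMSEQ_le_const2) (intro exI[of _ 0] allI impI damped, simp)
qed

section \<open>Fourier inversion for densities\<close>

text \<open>
  The positive and the negative part of \<open>p - g\<close> are densities of two measures that agree on half-open
  intervals, hence everywhere, so the two parts coincide and both vanish.
\<close>

lemma AE_eq_if_integrals_Ioc_eq:
  fixes p g :: "real \<Rightarrow> real"
  assumes p[measurable]: "p \<in> borel_measurable borel" and g[measurable]: "g \<in> borel_measurable borel"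
    and ip: "\<And>a b. set_integrable lborel {a<..b} p" and ig: "\<And>a b. set_integrable lborel {a<..b} g"
    and eq: "\<And>a b. a \<le> b \<Longrightarrow> (LINT x:{a<..b}|lborel. p x) = (LINT x:{a<..b}|lborel. g x)"
  shows "AE x in lborel. p x = g x"
proof -
  define h where "h x = p x - g x" for x
  have h[measurable]: "h \<in> borel_measurable borel" unfolding h_def by measurable
  have ih: "set_integrable lborel {a<..b} h" for a b
    unfolding h_def by (intro set_integral_diff ip ig)
  have pos: "(\<integral>\<^sup>+x\<in>{a<..b}. ennreal (h x) \<partial>lborel) < \<infinity> \<and>
      (\<integral>\<^sup>+x\<in>{a<..b}. ennreal (h x) \<partial>lborel) = (\<integral>\<^sup>+x\<in>{a<..b}. ennreal (- h x) \<partial>lborel)" if "a \<le> b" for a b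
  proof -
    let ?f = "\<lambda>x. indicator {a<..b} x *\<^sub>R h x"
    have int: "integrable lborel ?f" using ih by (simp add: set_integrable_def)
    have e1: "(\<integral>\<^sup>+x\<in>{a<..b}. ennreal (h x) \<partial>lborel) = (\<integral>\<^sup>+x. ennreal (?f x) \<partial>lborel)"
      by (intro nn_integral_cong) (auto split: split_indicator)
    have e2: "(\<integral>\<^sup>+x\<in>{a<..b}. ennreal (- h x) \<partial>lborel) = (\<integral>\<^sup>+x. ennreal (- ?f x) \<partial>lborel)"
      by (intro nn_integral_cong) (auto split: split_indicator)
    have f1: "(\<integral>\<^sup>+x. ennreal (?f x) \<partial>lborel) < \<infinity>" and f2: "(\<integral>\<^sup>+x. ennreal (- ?f x) \<partial>lborel) < \<infinity>"
      using int by (auto simp: real_integrable_def less_top)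
    have "(LINT x|lborel. ?f x) = 0"
      using set_integral_diff(2)[OF ip[of a b] ig[of a b]] eq[OF that]
      by (simp add: set_lebesgue_integral_def h_def)
    then have "enn2real (\<integral>\<^sup>+x. ennreal (?f x) \<partial>lborel) = enn2real (\<integral>\<^sup>+x. ennreal (- ?f x) \<partial>lborel)"
      using real_lebesgue_integral_def[OF int] by simp
    then have "(\<integral>\<^sup>+x. ennreal (?f x) \<partial>lborel) = (\<integral>\<^sup>+x. ennreal (- ?f x) \<partial>lborel)"
      using f1 f2 by (metis ennreal_enn2real infinity_ennreal_def)
    with f1 e1 e2 show ?thesis by simp
  qed
  have "density lborel (\<lambda>x. ennreal (h x)) = density lborel (\<lambda>x. ennreal (- h x))"
  proof (rule measure_eqI_generator_eq)
    let ?E = "range (\<lambda>(a, b). {a<..b::real})"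
    show "Int_stable ?E"
    proof (rule Int_stableI)
      fix A B assume "A \<in> ?E" "B \<in> ?E"
      then obtain a b c d where "A = {a<..b}" "B = {c<..d}" by auto
      then have "A \<inter> B = {max a c<..min b d}" by auto
      then show "A \<inter> B \<in> ?E" by auto
    qed
    show "?E \<subseteq> Pow UNIV" by simp
    show "sets (density lborel (\<lambda>x. ennreal (h x))) = sigma_sets UNIV ?E"
      and "sets (density lborel (\<lambda>x. ennreal (- h x))) = sigma_sets UNIV ?E"
      by (simp_all add: borel_sigma_sets_Ioc)
    show "range (\<lambda>n::nat. {- real n<..real n}) \<subseteq> ?E" by auto
    show "(\<Union>n. {- real n<..real n}) = UNIV"
    proof -
      have "\<exists>n. x \<in> {- real n<..real n}" for x
      proof -
        obtain n where "real n > \<bar>x\<bar>" using reals_Archimedean2 by blast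
        then show ?thesis by (intro exI[of _ n]) auto
      qed
      then show ?thesis by auto
    qed
    show "emeasure (density lborel (\<lambda>x. ennreal (h x))) {- real n<..real n} \<noteq> \<infinity>" for n
      using pos[of "- real n" "real n"] by (auto simp: emeasure_density)
    fix X assume "X \<in> ?E"
    then obtain a b where X: "X = {a<..b}" by auto
    show "emeasure (density lborel (\<lambda>x. ennreal (h x))) X = emeasure (density lborel (\<lambda>x. ennreal (- h x))) X"
    proof (cases "a \<le> b")
      case True then show ?thesis using pos[OF True] by (simp add: X emeasure_density)
    qed (simp add: X)
  qed
  then have "AE x in lborel. ennreal (h x) = ennreal (- h x)"
    by (subst (asm) sigma_finite_measure.density_unique_iff[OF sigma_finite_lborel]) auto
  then show ?thesis
  proof eventually_elim
    fix x assume "ennreal (h x) = ennreal (- h x)"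
    then have "h x = 0"
      by (cases "h x \<ge> 0") (auto simp: ennreal_neg ennreal_eq_0_iff dest: sym)
    then show "p x = g x" by (simp add: h_def)
  qed
qed

text \<open>
  Levy's inversion formula: for an integrable characteristic function the truncated integrals converge
  absolutely, and the kernel \<open>(exp (- i t a) - exp (- i t b)) / (i t)\<close> is the integral of
  \<open>exp (- i t x)\<close> over \<open>(a, b]\<close>.
\<close>

lemma measure_Ioc_eq_integral_char:
  assumes M: "real_distribution M" and int: "integrable lborel (char M)"
    and ab: "a \<le> b" and null: "measure M {a} = 0" "measure M {b} = 0"
  shows "of_real (measure M {a<..b}) = (LINT x:{a<..b}|lborel. 1 / (2 * pi) * (CLINT t|lborel. iexp (- (t * x)) * char M t))"
proof -
  interpret M: real_distribution M by fact
  have [measurable]: "char M \<in> borel_measurable borel" by auto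
  let ?F = "\<lambda>t. (iexp (-(t * a)) - iexp (-(t * b))) / (\<i> * t)"
  have F_bound: "norm (?F t) \<le> b - a" for t
  proof (cases "t = 0")
    case False
    have "?F t = - ((iexp (t * - b) - iexp (t * - a)) / (\<i> * t)) * 1 + 0"
      by (simp add: diff_divide_distrib)
    then show ?thesis
      using Levy_Inversion_aux2[of "-b" "-a" t] False ab by (simp add: norm_minus_commute norm_divide)
  qed (use ab in simp)
  have F_int: "integrable lborel (\<lambda>t. ?F t * char M t)"
  proof (rule Bochner_Integration.integrable_bound)
    show "integrable lborel (\<lambda>t. (b - a) * norm (char M t))" using int by simp
    show "AE t in lborel. norm (?F t * char M t) \<le> norm ((b - a) * norm (char M t))"
      using F_bound ab by (auto simp only: norm_mult intro!: AE_I2 mult_mono) auto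
  qed measurable
  have F_eq: "?F t = (CLINT x|lborel. indicator {a<..b} x *\<^sub>R iexp (- (t * x)))" if "t \<noteq> 0" for t
  proof -
    have "(CLBINT x=ereal a..ereal b. iexp (- (t * x))) = iexp (- (t * b)) * \<i> / t - iexp (- (t * a)) * \<i> / t"
      using that by (intro interval_integral_FTC_finite)
        (auto intro!: continuous_intros derivative_eq_intros simp: has_vector_derivative_complex_iff Re_exp Im_exp)
    also have "\<dots> = ?F t"
      using that by (simp add: field_simps)
    finally have "?F t = (CLBINT x=ereal a..ereal b. iexp (- (t * x)))" ..
    also have "\<dots> = (CLBINT x:{a<..b}. iexp (- (t * x)))"
      by (rule interval_integral_Ioc[OF ab])
    finally show ?thesis by (simp only: set_lebesgue_integral_def)
  qed
  have "(\<lambda>T. 1 / (2 * pi) * (CLBINT t=ereal (- real T)..ereal (real T). ?F t * char M t)) \<longlonglongrightarrow> of_real (measure M {a<..b})"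
    using M.Levy_Inversion[OF ab null] by simp
  moreover have "(\<lambda>T. 1 / (2 * pi) * (CLBINT t=ereal (- real T)..ereal (real T). ?F t * char M t)) \<longlonglongrightarrow> 1 / (2 * pi) * (CLINT t|lborel. ?F t * char M t)"
  proof (rule tendsto_mult_left)
    have "(\<lambda>T::nat. CLINT t|lborel. indicator {-real T<..<real T} t *\<^sub>R (?F t * char M t)) \<longlonglongrightarrow> (CLINT t|lborel. ?F t * char M t)"
    proof (rule integral_dominated_convergence)
      show "integrable lborel (\<lambda>t. norm (?F t * char M t))" using F_int by (rule integrable_norm)
      show "AE t in lborel. (\<lambda>T. indicator {-real T<..<real T} t *\<^sub>R (?F t * char M t)) \<longlonglongrightarrow> ?F t * char M t"
      proof (rule AE_I2, rule tendsto_eventually)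
        fix t
        obtain n where n: "real n > \<bar>t\<bar>" using reals_Archimedean2 by blast
        show "\<forall>\<^sub>F T in sequentially. indicator {-real T<..<real T} t *\<^sub>R (?F t * char M t) = ?F t * char M t"
          using eventually_ge_at_top[of n]
        proof eventually_elim
          fix T assume "n \<le> T"
          then have "\<bar>t\<bar> < real T" using n by linarith
          then have "t \<in> {-real T<..<real T}" by auto
          then show "indicator {-real T<..<real T} t *\<^sub>R (?F t * char M t) = ?F t * char M t"
            by (simp only: indicator_simps scaleR_one)
        qed
      qed
    qed (use F_int in \<open>auto split: split_indicator\<close>)
    also have "(\<lambda>T::nat. CLINT t|lborel. indicator {-real T<..<real T} t *\<^sub>R (?F t * char M t)) = (\<lambda>T. (CLBINT t=ereal (- real T)..ereal (real T). ?F t * char M t))"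
      by (auto simp: fun_eq_iff interval_lebesgue_integral_def set_lebesgue_integral_def)
    finally show "(\<lambda>T. (CLBINT t=ereal (- real T)..ereal (real T). ?F t * char M t)) \<longlonglongrightarrow> (CLINT t|lborel. ?F t * char M t)" .
  qed
  ultimately have "of_real (measure M {a<..b}) = 1 / (2 * pi) * (CLINT t|lborel. ?F t * char M t)"
    by (rule LIMSEQ_unique)
  also have "(CLINT t|lborel. ?F t * char M t) = (CLINT t|lborel. (CLINT x|lborel. indicator {a<..b} x *\<^sub>R iexp (- (t * x)) * char M t))"
  proof (rule integral_cong_AE)
    have "AE t in lborel. t \<noteq> (0::real)" by (rule AE_lborel_singleton)
    then show "AE t in lborel. ?F t * char M t = (CLINT x|lborel. indicator {a<..b} x *\<^sub>R iexp (- (t * x)) * char M t)"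
    proof eventually_elim
      fix t :: real assume "t \<noteq> 0"
      show "?F t * char M t = (CLINT x|lborel. indicator {a<..b} x *\<^sub>R iexp (- (t * x)) * char M t)"
        unfolding integral_mult_left_zero F_eq[OF \<open>t \<noteq> 0\<close>] ..
    qed
  qed measurable
  also have "\<dots> = (CLINT x|lborel. (CLINT t|lborel. indicator {a<..b} x *\<^sub>R iexp (- (t * x)) * char M t))"
  proof (rule lborel_pair.Fubini_integral, rule lborel_pair.Fubini_integrable)
    have "integrable lborel (indicator {a<..b} :: real \<Rightarrow> real)"
      using ab by (intro integrable_real_indicator) auto
    moreover have "(\<lambda>x. LINT t|lborel. norm (indicator {a<..b} x *\<^sub>R iexp (- (t * x)) * char M t))
        = (\<lambda>x. indicator {a<..b} x *\<^sub>R (LINT t|lborel. norm (char M t)))"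
      by (auto simp: norm_mult simp del: of_real_mult of_real_minus)
    ultimately show "integrable lborel (\<lambda>x. LINT t|lborel. norm (case (x, t) of (x, t) \<Rightarrow> indicator {a<..b} x *\<^sub>R iexp (- (t * x)) * char M t))"
      by (auto simp: norm_mult simp del: of_real_mult of_real_minus)
    show "AE x in lborel. integrable lborel (\<lambda>t. case (x, t) of (x, t) \<Rightarrow> indicator {a<..b} x *\<^sub>R iexp (- (t * x)) * char M t)"
      by (auto intro!: AE_I2 Bochner_Integration.integrable_bound[OF integrable_norm[OF int]] simp: norm_mult split: split_indicator simp del: of_real_mult of_real_minus)
  qed measurable
  also have "1 / (2 * pi) * \<dots> = (LINT x:{a<..b}|lborel. 1 / (2 * pi) * (CLINT t|lborel. iexp (- (t * x)) * char M t))"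
    unfolding set_lebesgue_integral_def integral_mult_right_zero[symmetric]
    by (intro Bochner_Integration.integral_cong refl) (auto split: split_indicator)
  finally show ?thesis .
qed

lemma fourier_inversion_AE:
  fixes p :: "real \<Rightarrow> real"
  assumes p[measurable]: "p \<in> borel_measurable borel" and nn: "\<And>x. 0 \<le> p x"
    and D: "real_distribution (density lborel (\<lambda>x. ennreal (p x)))"
    and int: "integrable lborel (char (density lborel (\<lambda>x. ennreal (p x))))"
  shows "AE x in lborel. p x = Re (CLINT t|lborel. iexp (- (t * x)) * char (density lborel (\<lambda>x. ennreal (p x))) t) / (2 * pi)"
proof (rule AE_eq_if_integrals_Ioc_eq)
  define M where "M = density lborel (\<lambda>x. ennreal (p x))"
  interpret M: real_distribution M using D by (simp add: M_def)
  note int = int[folded M_def]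
  have [measurable]: "char M \<in> borel_measurable borel" by auto
  define G where "G x = (CLINT t|lborel. iexp (- (t * x)) * char M t)" for x
  have [measurable]: "G \<in> borel_measurable borel" unfolding G_def by measurable
  have G_bound: "norm (G x) \<le> (LINT t|lborel. norm (char M t))" for x
  proof -
    have "norm (G x) \<le> (LINT t|lborel. norm (iexp (- (t * x)) * char M t))"
      unfolding G_def by (rule integral_norm_bound)
    then show ?thesis by (simp add: norm_mult del: of_real_mult of_real_minus)
  qed
  show "(\<lambda>x. Re (CLINT t|lborel. iexp (- (t * x)) * char (density lborel (\<lambda>x. ennreal (p x))) t) / (2 * pi)) \<in> borel_measurable borel"
    unfolding M_def[symmetric] G_def[symmetric] by measurable
  have "integrable lborel p"
    using M.emeasure_space_1 nn
    by (intro integrableI_nonneg) (auto simp: M_def emeasure_density)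
  then show ip: "set_integrable lborel {a<..b} p" for a b
    unfolding set_integrable_def by (rule integrable_mult_indicator[rotated]) simp
  have iG: "set_integrable lborel {a<..b} G" for a b
    unfolding set_integrable_def
  proof (rule Bochner_Integration.integrable_bound)
    show "integrable lborel (\<lambda>x. indicator {a<..b} x * (LINT t|lborel. norm (char M t)))"
      by (intro integrable_mult_left integrable_real_indicator) (cases "a \<le> b"; simp)+
    show "AE x in lborel. norm (indicator {a<..b} x *\<^sub>R G x) \<le> norm (indicator {a<..b} x * (LINT t|lborel. norm (char M t)))"
      using G_bound by (auto split: split_indicator)
  qed measurable
  then have iRe: "set_integrable lborel {a<..b} (\<lambda>x. Re (G x))" for a b
    using integrable_Re[of lborel "\<lambda>x. indicator {a<..b} x *\<^sub>R G x"] by (simp add: set_integrable_def)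
  then show "set_integrable lborel {a<..b} (\<lambda>x. Re (CLINT t|lborel. iexp (- (t * x)) * char (density lborel (\<lambda>x. ennreal (p x))) t) / (2 * pi))" for a b
    unfolding M_def[symmetric] G_def[symmetric] by (rule set_integrable_divide)
  fix a b :: real assume ab: "a \<le> b"
  have null: "measure M {x} = 0" for x
  proof -
    have "emeasure M {x} = (\<integral>\<^sup>+y. ennreal (p y) * indicator {x} y \<partial>lborel)"
      by (simp add: M_def emeasure_density)
    also have "\<dots> = (\<integral>\<^sup>+y. 0 \<partial>(lborel :: real measure))"
    proof (rule nn_integral_cong_AE)
      show "AE y in lborel. ennreal (p y) * indicator {x} y = 0"
        using AE_lborel_singleton[of x] by eventually_elim simp
    qed
    finally show ?thesis by (simp add: measure_def)
  qed
  have "measure M {a<..b} = Re (LINT x:{a<..b}|lborel. 1 / (2 * pi) * G x)"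
    using measure_Ioc_eq_integral_char[OF M.real_distribution_axioms int ab null null]
    unfolding G_def by (metis Re_complex_of_real)
  also have "\<dots> = (LINT x|lborel. Re (indicator {a<..b} x *\<^sub>R (1 / (2 * pi) * G x)))"
    unfolding set_lebesgue_integral_def
  proof (rule integral_Re[symmetric])
    have "integrable lborel (\<lambda>x. complex_of_real (1 / (2 * pi)) * (indicator {a<..b} x *\<^sub>R G x))"
      using iG[of a b] by (intro integrable_mult_right) (simp add: set_integrable_def)
    then show "integrable lborel (\<lambda>x. indicator {a<..b} x *\<^sub>R (complex_of_real (1 / (2 * pi)) * G x))"
      by simp
  qed
  also have "\<dots> = (LINT x:{a<..b}|lborel. Re (G x) / (2 * pi))"
    unfolding set_lebesgue_integral_def by (intro Bochner_Integration.integral_cong) auto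
  finally have 1: "measure M {a<..b} = (LINT x:{a<..b}|lborel. Re (G x) / (2 * pi))" .
  have "ennreal (measure M {a<..b}) = (\<integral>\<^sup>+x. ennreal (p x) * indicator {a<..b} x \<partial>lborel)"
    using M.emeasure_eq_measure[of "{a<..b}"] by (simp add: M_def emeasure_density)
  also have "\<dots> = (\<integral>\<^sup>+x. ennreal (indicator {a<..b} x *\<^sub>R p x) \<partial>lborel)"
    by (intro nn_integral_cong) (auto split: split_indicator)
  also have "\<dots> = ennreal (LINT x:{a<..b}|lborel. p x)"
    unfolding set_lebesgue_integral_def
    using ip[of a b] nn by (intro nn_integral_eq_integral) (auto simp: set_integrable_def)
  finally have "measure M {a<..b} = (LINT x:{a<..b}|lborel. p x)"
    using nn by (subst (asm) ennreal_inj) (auto simp: set_lebesgue_integral_def intro!: integral_nonneg_AE)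
  with 1 show "(LINT x:{a<..b}|lborel. p x) = (LINT x:{a<..b}|lborel. Re (CLINT t|lborel. iexp (- (t * x)) * char (density lborel (\<lambda>x. ennreal (p x))) t) / (2 * pi))"
    unfolding M_def[symmetric] G_def[symmetric] by simp
qed (auto simp: p)

section \<open>Tilted laws of normalized sums\<close>

text \<open>
  Along the imaginary axis this is the characteristic function, along the real axis the moment generating
  function. Having both in one function, the product formula for independent sums is proved once.
\<close>

definition cmgf :: "real measure \<Rightarrow> complex \<Rightarrow> complex" where
  "cmgf \<mu> z = (CLINT x|\<mu>. exp (z * of_real x))"

definition mgf :: "real measure \<Rightarrow> real \<Rightarrow> real" where
  "mgf \<mu> h = (LINT x|\<mu>. exp (h * x))"

text \<open>
  The Esscher (or Cramer) transform of \<open>\<mu>\<close>.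
\<close>

definition tilt :: "real measure \<Rightarrow> real \<Rightarrow> real measure" where
  "tilt \<mu> h = density \<mu> (\<lambda>x. ennreal (exp (h * x) / mgf \<mu> h))"

lemma cmgf_of_real: "cmgf \<mu> (of_real h) = of_real (mgf \<mu> h)"
  unfolding cmgf_def mgf_def
  by (subst integral_complex_of_real[symmetric]) (simp flip: exp_of_real)

context real_distribution
begin

lemma mgf_pos:
  assumes "integrable M (\<lambda>x. exp (h * x))"
  shows "mgf M h > 0"
proof -
  have "mgf M h \<noteq> 0"
  proof
    assume "mgf M h = 0"
    then have "AE x in M. exp (h * x) = 0"
      unfolding mgf_def using assms by (subst (asm) integral_nonneg_eq_0_iff_AE) auto
    then show False using AE_False by simp
  qed
  moreover have "mgf M h \<ge> 0" unfolding mgf_def by (simp add: integral_nonneg_AE)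
  ultimately show ?thesis by simp
qed

lemma integral_tilt:
  fixes f :: "real \<Rightarrow> 'b::{banach, second_countable_topology}"
  assumes int: "integrable M (\<lambda>x. exp (h * x))" and f[measurable]: "f \<in> borel_measurable borel"
  shows "(LINT x|tilt M h. f x) = (LINT x|M. exp (h * x) *\<^sub>R f x) /\<^sub>R mgf M h"
    and "integrable (tilt M h) f \<longleftrightarrow> integrable M (\<lambda>x. exp (h * x) *\<^sub>R f x)"
proof -
  note pos = mgf_pos[OF int]
  have "(LINT x|tilt M h. f x) = (LINT x|M. (exp (h * x) / mgf M h) *\<^sub>R f x)"
    unfolding tilt_def using pos by (intro integral_density) auto
  also have "\<dots> = (LINT x|M. inverse (mgf M h) *\<^sub>R (exp (h * x) *\<^sub>R f x))"
    by (simp add: divide_inverse mult.commute)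
  also have "\<dots> = inverse (mgf M h) *\<^sub>R (LINT x|M. exp (h * x) *\<^sub>R f x)"
    by (rule integral_scaleR_right)
  finally show "(LINT x|tilt M h. f x) = (LINT x|M. exp (h * x) *\<^sub>R f x) /\<^sub>R mgf M h" .
  have "integrable (tilt M h) f \<longleftrightarrow> integrable M (\<lambda>x. (exp (h * x) / mgf M h) *\<^sub>R f x)"
    unfolding tilt_def using pos by (intro integrable_density) auto
  also have "\<dots> \<longleftrightarrow> integrable M (\<lambda>x. inverse (mgf M h) *\<^sub>R (exp (h * x) *\<^sub>R f x))"
    by (simp add: divide_inverse mult.commute)
  also have "\<dots> \<longleftrightarrow> integrable M (\<lambda>x. exp (h * x) *\<^sub>R f x)"
  proof
    assume *: "integrable M (\<lambda>x. inverse (mgf M h) *\<^sub>R (exp (h * x) *\<^sub>R f x))"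
    have "integrable M (\<lambda>x. mgf M h *\<^sub>R (inverse (mgf M h) *\<^sub>R (exp (h * x) *\<^sub>R f x)))"
      by (rule integrable_scaleR_right) (rule *)
    then show "integrable M (\<lambda>x. exp (h * x) *\<^sub>R f x)"
      using pos by (simp add: mult.assoc[symmetric])
  qed (rule integrable_scaleR_right)
  finally show "integrable (tilt M h) f \<longleftrightarrow> integrable M (\<lambda>x. exp (h * x) *\<^sub>R f x)" .
qed

lemma real_distribution_tilt:
  assumes int: "integrable M (\<lambda>x. exp (h * x))"
  shows "real_distribution (tilt M h)"
proof -
  note pos = mgf_pos[OF int]
  have "emeasure (tilt M h) (space (tilt M h)) = (\<integral>\<^sup>+x. ennreal (exp (h * x) / mgf M h) \<partial>M)"
    unfolding tilt_def by (simp add: emeasure_density)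
  also have "\<dots> = ennreal (LINT x|M. exp (h * x) / mgf M h)"
    using int pos by (intro nn_integral_eq_integral) auto
  also have "\<dots> = 1" using pos by (simp flip: mgf_def)
  finally have "prob_space (tilt M h)" by (rule prob_spaceI)
  then show ?thesis
    by (simp add: real_distribution_def real_distribution_axioms_def tilt_def)
qed

lemma char_tilt:
  assumes int: "integrable M (\<lambda>x. exp (h * x))"
  shows "char (tilt M h) t = cmgf M (Complex h t) / cmgf M (of_real h)"
proof -
  have "char (tilt M h) t = (CLINT x|M. exp (h * x) *\<^sub>R iexp (t * x)) /\<^sub>R mgf M h"
    unfolding char_def by (rule integral_tilt(1)[OF int]) measurable
  also have "(\<lambda>x. exp (h * x) *\<^sub>R iexp (t * x)) = (\<lambda>x. exp (Complex h t * of_real x))"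
    by (auto simp: fun_eq_iff scaleR_conv_of_real exp_of_real[symmetric] Complex_eq algebra_simps simp flip: exp_add)
  finally show ?thesis
    unfolding cmgf_def[symmetric] by (simp add: cmgf_of_real scaleR_conv_of_real divide_inverse)
qed

lemma tilt_0: "tilt M 0 = M"
  by (simp add: tilt_def mgf_def density_1)
end

lemma tilt_density:
  fixes p :: "real \<Rightarrow> real"
  assumes p[measurable]: "p \<in> borel_measurable borel" and nn: "\<And>x. 0 \<le> p x"
    and pos: "mgf (density lborel (\<lambda>x. ennreal (p x))) h > 0"
  shows "tilt (density lborel (\<lambda>x. ennreal (p x))) h
     = density lborel (\<lambda>x. ennreal (p x * exp (h * x) / mgf (density lborel (\<lambda>x. ennreal (p x))) h))"
proof -
  have "density (density lborel (\<lambda>x. ennreal (p x))) (\<lambda>x. ennreal (exp (h * x) / m))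
      = density lborel (\<lambda>x. ennreal (p x * exp (h * x) / m))" if "m > 0" for m
    using that nn by (subst density_density_eq) (auto simp flip: ennreal_mult intro!: density_cong)
  then show ?thesis using pos unfolding tilt_def by blast
qed

locale iid_sums = prob_space M for M :: "'a measure" +
  fixes \<nu> :: "real measure" and Xs :: "nat \<Rightarrow> 'a \<Rightarrow> real"
  assumes indep: "indep_vars (\<lambda>_. borel) Xs {1..}"
    and law: "\<And>i. i \<ge> 1 \<Longrightarrow> distr M borel (Xs i) = \<nu>"
begin

lemma Xs_measurable: "i \<ge> 1 \<Longrightarrow> Xs i \<in> borel_measurable M"
  using indep by (auto simp: indep_vars_def)

sublocale nu: real_distribution \<nu>
  using real_distribution_distr[OF Xs_measurable[of 1]] law[of 1] by simp

lemma normalized_sum_measurable [measurable]: "normalized_sum Xs n \<in> borel_measurable M"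
  unfolding normalized_sum_def using Xs_measurable by (intro borel_measurable_divide borel_measurable_sum) auto

definition sum_law :: "nat \<Rightarrow> real measure" where
  "sum_law n = distr M borel (normalized_sum Xs n)"

lemma real_distribution_sum_law: "real_distribution (sum_law n)"
  unfolding sum_law_def by simp

lemma sum_law_density:
  assumes "has_density M (normalized_sum Xs n) q"
  shows "q \<in> borel_measurable borel" "\<And>x. 0 \<le> q x" "sum_law n = density lborel (\<lambda>x. ennreal (q x))"
proof -
  show "q \<in> borel_measurable borel" "\<And>x. 0 \<le> q x" using assms by (auto simp: has_density_def)
  have "distr M borel (normalized_sum Xs n) = distr M lborel (normalized_sum Xs n)"
    by (rule distr_cong) auto
  then show "sum_law n = density lborel (\<lambda>x. ennreal (q x))"
    using assms by (simp add: has_density_def distributed_def sum_law_def)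
qed

lemma cmgf_sum_law:
  assumes int: "integrable \<nu> (\<lambda>x. exp (Re z / sqrt (real n) * x))"
  shows "integrable (sum_law n) (\<lambda>x. exp (Re z * x))"
    and "cmgf (sum_law n) z = cmgf \<nu> (z / of_real (sqrt (real n))) ^ n"
proof -
  let ?w = "z / of_real (sqrt (real n))"
  let ?f = "\<lambda>x. exp (?w * of_real x)"
  let ?Y = "\<lambda>i \<omega>. ?f (Xs i \<omega>)"
  have Xm: "Xs i \<in> borel_measurable M" if "i \<in> {1..n}" for i
    using that Xs_measurable by auto
  have ind: "indep_vars (\<lambda>_. borel) ?Y {1..n}"
    by (rule indep_vars_compose2[OF indep_vars_subset[OF indep]]) auto
  have "integrable \<nu> ?f"
    by (rule Bochner_Integration.integrable_bound[OF int]) (auto simp: norm_exp_eq_Re)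
  then have integrable_Y: "integrable M (?Y i)" and int_Y: "(CLINT \<omega>|M. ?Y i \<omega>) = cmgf \<nu> ?w"
    if "i \<in> {1..n}" for i
  proof -
    have d: "distr M borel (Xs i) = \<nu>" using that law by auto
    show "integrable M (?Y i)" 
      using \<open>integrable \<nu> ?f\<close> Xm[OF that] unfolding d[symmetric] by (subst (asm) integrable_distr_eq) auto
    show "(CLINT \<omega>|M. ?Y i \<omega>) = cmgf \<nu> ?w"
      unfolding cmgf_def d[symmetric] using Xm[OF that] by (subst integral_distr) auto
  qed
  have prod: "(\<Prod>i\<in>{1..n}. ?Y i \<omega>) = exp (z * of_real (normalized_sum Xs n \<omega>))" for \<omega>
    by (subst exp_sum[symmetric]) (simp_all add: normalized_sum_def sum_distrib_left sum_divide_distrib)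
  have "integrable M (\<lambda>\<omega>. exp (z * of_real (normalized_sum Xs n \<omega>)))"
    unfolding prod[symmetric] by (rule indep_vars_integrable[OF _ ind integrable_Y]) auto
  then have "integrable M (\<lambda>\<omega>. norm (exp (z * of_real (normalized_sum Xs n \<omega>))))"
    by (rule integrable_norm)
  then show "integrable (sum_law n) (\<lambda>x. exp (Re z * x))"
    unfolding sum_law_def by (subst integrable_distr_eq) (auto simp: norm_exp_eq_Re)
  have "cmgf (sum_law n) z = (CLINT \<omega>|M. (\<Prod>i\<in>{1..n}. ?Y i \<omega>))"
    unfolding cmgf_def sum_law_def prod by (subst integral_distr) auto
  also have "\<dots> = (\<Prod>i\<in>{1..n}. CLINT \<omega>|M. ?Y i \<omega>)"
    by (rule indep_vars_lebesgue_integral[OF _ ind integrable_Y]) auto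
  also have "\<dots> = (\<Prod>i\<in>{1..n}. cmgf \<nu> ?w)"
    by (intro prod.cong refl int_Y)
  also have "\<dots> = cmgf \<nu> ?w ^ n"
    by simp
  finally show "cmgf (sum_law n) z = cmgf \<nu> ?w ^ n" .
qed

lemma mgf_sum_law:
  assumes int: "integrable \<nu> (\<lambda>x. exp (h / sqrt (real n) * x))"
  shows "mgf (sum_law n) h = mgf \<nu> (h / sqrt (real n)) ^ n"
proof -
  have "complex_of_real (mgf (sum_law n) h) = cmgf (sum_law n) (of_real h)"
    by (simp add: cmgf_of_real)
  also have "\<dots> = cmgf \<nu> (of_real h / of_real (sqrt (real n))) ^ n"
    using int by (intro cmgf_sum_law) simp
  also have "of_real h / of_real (sqrt (real n)) = complex_of_real (h / sqrt (real n))"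
    by simp
  also have "cmgf \<nu> (complex_of_real (h / sqrt (real n))) ^ n = of_real (mgf \<nu> (h / sqrt (real n)) ^ n)"
    unfolding cmgf_of_real by simp
  finally show ?thesis using of_real_eq_iff by blast
qed

text \<open>
  Tilting commutes with forming independent sums: the normalized sum tilted by \<open>h\<close> is distributed like
  the normalized sum of copies of \<open>X\<close> tilted by \<open>h / sqrt n\<close>.
\<close>

lemma char_tilt_sum_law:
  assumes int: "integrable \<nu> (\<lambda>x. exp (h / sqrt (real n) * x))"
  shows "char (tilt (sum_law n) h) t = char (tilt \<nu> (h / sqrt (real n))) (t / sqrt (real n)) ^ n"
proof -
  have int': "integrable (sum_law n) (\<lambda>x. exp (h * x))"
    using cmgf_sum_law(1)[of "of_real h" n] int by simp
  have "Complex h t / of_real (sqrt (real n)) = Complex (h / sqrt (real n)) (t / sqrt (real n))"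
    by (simp add: complex_eq_iff)
  moreover have "complex_of_real h / of_real (sqrt (real n)) = of_real (h / sqrt (real n))"
    by simp
  moreover have "cmgf (sum_law n) (Complex h t) = cmgf \<nu> (Complex h t / of_real (sqrt (real n))) ^ n"
    "cmgf (sum_law n) (of_real h) = cmgf \<nu> (of_real h / of_real (sqrt (real n))) ^ n"
    using int by (auto intro!: cmgf_sum_law)
  ultimately show ?thesis
    using real_distribution.char_tilt[OF real_distribution_sum_law int'] nu.char_tilt[OF int]
    by (simp add: power_divide)
qed

end

section \<open>Necessity of strict subgaussianity\<close>

lemma renyi_integral_le_of_divergence_le_1:
  assumes \<alpha>: "\<alpha> > 1" and D: "renyi_divergence_normal \<alpha> p < 1"
  shows "(\<integral>\<^sup>+x. ennreal ((p x / std_normal_density x) powr \<alpha> * std_normal_density x) \<partial>lborel) \<le> ennreal (exp (\<alpha> - 1))"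
    (is "?T \<le> _")
proof (cases "?T = 0")
  case False
  have D': "ereal (1 / (\<alpha> - 1)) * ln_ennreal ?T < 1"
    using D \<alpha> by (simp add: renyi_divergence_normal_def)
  have fin: "?T \<noteq> \<infinity>"
  proof
    assume "?T = \<infinity>"
    then show False using D' \<alpha> by (simp add: ln_ennreal_def)
  qed
  then obtain r where r: "?T = ennreal r" "r > 0"
    using False by (cases ?T) (auto simp: less_le)
  have "1 / (\<alpha> - 1) * ln r < 1"
    using D' fin False r by (simp add: ln_ennreal_def)
  then have "ln r < \<alpha> - 1" using \<alpha> by (simp add: field_simps)
  then have "r \<le> exp (\<alpha> - 1)" using r by (metis exp_less_mono exp_ln less_imp_le)
  then show ?thesis using r by (simp add: ennreal_leI)
qed simp

text \<open>
  Young's inequality for \<open>u = p / \<phi>\<close> and \<open>v = exp (s x - \<beta> s\<^sup>2 / 2)\<close>. The normalization of \<open>v\<close> is chosen so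
  that \<open>v powr \<beta> \<phi>\<close> is the normal density with mean \<open>\<beta> s\<close>, which has integral \<open>1\<close>.
\<close>

lemma mgf_le_of_renyi_integral:
  assumes \<alpha>: "\<alpha> > 1" and p[measurable]: "p \<in> borel_measurable borel" and p0: "\<And>x. 0 \<le> p x"
  defines "\<beta> \<equiv> \<alpha> / (\<alpha> - 1)"
  shows "(\<integral>\<^sup>+x. ennreal (exp (s * x)) * ennreal (p x) \<partial>lborel)
    \<le> ennreal (exp (\<beta> * s\<^sup>2 / 2)) * ((\<integral>\<^sup>+x. ennreal ((p x / std_normal_density x) powr \<alpha> * std_normal_density x) \<partial>lborel) + 1)"
proof -
  let ?\<phi> = std_normal_density
  have \<phi>: "?\<phi> x > 0" for x by (simp add: normal_density_pos)
  have \<beta>: "\<beta> > 1" "1 / \<alpha> + 1 / \<beta> = 1" using \<alpha> by (auto simp: \<beta>_def field_simps)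
  have "(\<integral>\<^sup>+x. ennreal (exp (s * x)) * ennreal (p x) \<partial>lborel)
     \<le> (\<integral>\<^sup>+x. ennreal (exp (\<beta> * s\<^sup>2 / 2)) * (ennreal ((p x / ?\<phi> x) powr \<alpha> * ?\<phi> x) + ennreal (normal_density (\<beta> * s) 1 x)) \<partial>lborel)"
  proof (rule nn_integral_mono)
    fix x
    define u where "u = p x / ?\<phi> x"
    define v where "v = exp (s * x - \<beta> * s\<^sup>2 / 2)"
    have u0: "u \<ge> 0" using p0 \<phi>[of x] by (simp add: u_def)
    have "u * v \<le> u powr \<alpha> / \<alpha> + v powr \<beta> / \<beta>"
      using \<alpha> \<beta> u0 by (intro Youngs_inequality) (auto simp: v_def)
    also have "\<dots> \<le> u powr \<alpha> / 1 + v powr \<beta> / 1"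
      using \<alpha> \<beta> by (intro add_mono divide_left_mono) auto
    finally have "u * v \<le> u powr \<alpha> + v powr \<beta>" by simp
    then have "u * v * ?\<phi> x \<le> (u powr \<alpha> + v powr \<beta>) * ?\<phi> x"
      by (intro mult_right_mono) auto
    moreover have "v powr \<beta> * ?\<phi> x = normal_density (\<beta> * s) 1 x"
    proof -
      have "v powr \<beta> * exp (- x\<^sup>2 / 2) = exp (- (x - \<beta> * s)\<^sup>2 / 2)"
        by (simp add: v_def exp_powr_real power2_diff power_mult_distrib field_simps power2_eq_square flip: exp_add)
      then show ?thesis
        by (simp add: normal_density_def ac_simps)
    qed
    moreover have "u * ?\<phi> x = p x" using \<phi>[of x] by (simp add: u_def)
    moreover have "p x * v = u * v * ?\<phi> x"
      using \<open>u * ?\<phi> x = p x\<close> by (metis mult.assoc mult.commute)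
    ultimately have "p x * v \<le> u powr \<alpha> * ?\<phi> x + normal_density (\<beta> * s) 1 x"
      by (simp only: distrib_right)
    then have "exp (\<beta> * s\<^sup>2 / 2) * (p x * v) \<le> exp (\<beta> * s\<^sup>2 / 2) * (u powr \<alpha> * ?\<phi> x + normal_density (\<beta> * s) 1 x)"
      by (intro mult_left_mono) auto
    moreover have "exp (\<beta> * s\<^sup>2 / 2) * (p x * v) = exp (s * x) * p x"
      by (simp add: v_def exp_diff)
    ultimately show "ennreal (exp (s * x)) * ennreal (p x) \<le> ennreal (exp (\<beta> * s\<^sup>2 / 2)) * (ennreal ((p x / ?\<phi> x) powr \<alpha> * ?\<phi> x) + ennreal (normal_density (\<beta> * s) 1 x))"
      using p0[of x] by (simp add: u_def ennreal_leI flip: ennreal_mult ennreal_plus)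
  qed
  also have "\<dots> = ennreal (exp (\<beta> * s\<^sup>2 / 2)) * (\<integral>\<^sup>+x. ennreal ((p x / ?\<phi> x) powr \<alpha> * ?\<phi> x) + ennreal (normal_density (\<beta> * s) 1 x) \<partial>lborel)"
    by (rule nn_integral_cmult) measurable
  also have "(\<integral>\<^sup>+x. ennreal ((p x / ?\<phi> x) powr \<alpha> * ?\<phi> x) + ennreal (normal_density (\<beta> * s) 1 x) \<partial>lborel)
      = (\<integral>\<^sup>+x. ennreal ((p x / ?\<phi> x) powr \<alpha> * ?\<phi> x) \<partial>lborel) + (\<integral>\<^sup>+x. ennreal (normal_density (\<beta> * s) 1 x) \<partial>lborel)"
    by (rule nn_integral_add) auto
  also have "(\<integral>\<^sup>+x. ennreal (normal_density (\<beta> * s) 1 x) \<partial>lborel) = 1"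
    by (subst nn_integral_eq_integral) auto
  finally show ?thesis .
qed

lemma ennreal_le_exp_of_power_le:
  fixes L :: ennreal and C b :: real
  assumes "\<forall>\<^sub>F n in sequentially. L ^ n \<le> ennreal (C * exp (real n * b))"
  shows "L \<le> ennreal (exp b)"
proof (rule ccontr)
  assume neg: "\<not> ?thesis"
  obtain N where N: "\<And>n. n \<ge> N \<Longrightarrow> L ^ n \<le> ennreal (C * exp (real n * b))"
    using assms unfolding eventually_sequentially by blast
  have "L ^ Suc N < \<top>" using N[of "Suc N"] by (auto intro: le_less_trans)
  then have "L < \<top>" by (simp only: power_less_top_ennreal) simp
  then obtain l where l: "L = ennreal l" "l \<ge> 0" by (cases L) auto
  have le: "exp b < l" using neg l by (simp add: not_le ennreal_less_iff)
  then have "1 < l / exp b" by simp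
  then obtain m where m: "\<bar>C\<bar> < (l / exp b) ^ m" using real_arch_pow by blast
  define n where "n = max m N"
  have "(l / exp b) ^ m \<le> (l / exp b) ^ n"
    using \<open>1 < l / exp b\<close> by (intro power_increasing) (auto simp: n_def)
  with m have "\<bar>C\<bar> < (l / exp b) ^ n" by simp
  then have "\<bar>C\<bar> * exp (real n * b) < l ^ n"
    by (simp add: power_divide exp_of_nat_mult less_divide_eq)
  moreover have "ennreal (l ^ n) \<le> ennreal (\<bar>C\<bar> * exp (real n * b))"
  proof -
    have "ennreal (l ^ n) \<le> ennreal (C * exp (real n * b))" using N[of n] l by (simp add: n_def ennreal_power)
    also have "\<dots> \<le> ennreal (\<bar>C\<bar> * exp (real n * b))" by (intro ennreal_leI mult_right_mono) auto
    finally show ?thesis .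
  qed
  ultimately show False by (simp add: ennreal_le_iff)
qed

context iid_sums
begin

lemma nn_integral_exp_sum_law:
  "(\<integral>\<^sup>+x. ennreal (exp (s * x)) \<partial>sum_law n) = (\<integral>\<^sup>+x. ennreal (exp (s / sqrt (real n) * x)) \<partial>\<nu>) ^ n"
proof -
  let ?Y = "\<lambda>i \<omega>. ennreal (exp (s / sqrt (real n) * Xs i \<omega>))"
  have ind: "indep_vars (\<lambda>_. borel) ?Y {1..n}"
    by (rule indep_vars_compose2[OF indep_vars_subset[OF indep]]) auto
  have Y: "(\<integral>\<^sup>+\<omega>. ?Y i \<omega> \<partial>M) = (\<integral>\<^sup>+x. ennreal (exp (s / sqrt (real n) * x)) \<partial>\<nu>)" if "i \<in> {1..n}" for i
  proof -
    have d: "distr M borel (Xs i) = \<nu>" using that law by auto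
    show ?thesis unfolding d[symmetric] using that by (subst nn_integral_distr) (auto intro: Xs_measurable)
  qed
  have "(\<integral>\<^sup>+x. ennreal (exp (s * x)) \<partial>sum_law n) = (\<integral>\<^sup>+\<omega>. ennreal (exp (s * normalized_sum Xs n \<omega>)) \<partial>M)"
    unfolding sum_law_def by (subst nn_integral_distr) auto
  also have "\<dots> = (\<integral>\<^sup>+\<omega>. (\<Prod>i\<in>{1..n}. ?Y i \<omega>) \<partial>M)"
  proof (rule nn_integral_cong)
    fix \<omega>
    have "exp (s * normalized_sum Xs n \<omega>) = (\<Prod>i\<in>{1..n}. exp (s / sqrt (real n) * Xs i \<omega>))"
      by (subst exp_sum[symmetric]) (simp_all add: normalized_sum_def sum_distrib_left sum_divide_distrib)
    then show "ennreal (exp (s * normalized_sum Xs n \<omega>)) = (\<Prod>i\<in>{1..n}. ?Y i \<omega>)"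
      by (simp only: prod_ennreal exp_ge_zero)
  qed
  also have "\<dots> = (\<Prod>i\<in>{1..n}. \<integral>\<^sup>+\<omega>. ?Y i \<omega> \<partial>M)"
    by (rule indep_vars_nn_integral[OF _ ind]) auto
  also have "\<dots> = (\<Prod>i\<in>{1..n}. \<integral>\<^sup>+x. ennreal (exp (s / sqrt (real n) * x)) \<partial>\<nu>)"
    by (intro prod.cong refl Y)
  finally show ?thesis by simp
qed

text \<open>
  At \<open>s = t sqrt n\<close> the moment generating function of the normalized sum is \<open>L(t) ^ n\<close>, while the Gaussian
  bound is \<open>exp (\<beta> t\<^sup>2 / 2) ^ n\<close> up to a constant independent of \<open>n\<close>. The growth rates in \<open>n\<close> therefore compare, for
  each \<open>\<beta> > 1\<close>.
\<close>

lemma mgf_le_of_renyi_tendsto: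
  assumes dens: "\<forall>\<^sub>F n in sequentially. has_density M (normalized_sum Xs n) (p n)"
    and lim: "\<And>\<alpha>. \<alpha> > 1 \<Longrightarrow> (\<lambda>n. renyi_divergence_normal \<alpha> (p n)) \<longlonglongrightarrow> 0"
  shows "(\<integral>\<^sup>+x. ennreal (exp (t * x)) \<partial>\<nu>) \<le> ennreal (exp (t\<^sup>2 / 2))"
proof -
  let ?L = "\<integral>\<^sup>+x. ennreal (exp (t * x)) \<partial>\<nu>"
  have \<beta>_bound: "?L \<le> ennreal (exp (\<beta> * t\<^sup>2 / 2))" if \<beta>: "\<beta> > 1" for \<beta>
  proof -
    \<comment> \<open>The exponent conjugate to \<open>\<beta>\<close>.\<close>
    define \<alpha> where "\<alpha> = \<beta> / (\<beta> - 1)"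
    have \<alpha>: "\<alpha> > 1" "\<alpha> / (\<alpha> - 1) = \<beta>" using \<beta> by (auto simp: \<alpha>_def field_simps)
    define C where "C = exp (\<alpha> - 1) + 1"
    have C: "C \<ge> 0" by (simp add: C_def add_nonneg_nonneg)
    have "\<forall>\<^sub>F n in sequentially. renyi_divergence_normal \<alpha> (p n) < 1"
      using lim[OF \<alpha>(1)] by (rule order_tendstoD) simp
    then have "\<forall>\<^sub>F n in sequentially. ?L ^ n \<le> ennreal (C * exp (real n * (\<beta> * t\<^sup>2 / 2)))"
      using dens eventually_gt_at_top[of 0]
    proof eventually_elim
      fix n assume D: "renyi_divergence_normal \<alpha> (p n) < 1" and d: "has_density M (normalized_sum Xs n) (p n)" and n: "0 < n"
      note q = sum_law_density[OF d]
      note [measurable] = q(1)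
      let ?s = "t * sqrt (real n)"
      have "?L ^ n = (\<integral>\<^sup>+x. ennreal (exp (?s * x)) \<partial>sum_law n)"
        using n by (subst nn_integral_exp_sum_law) simp
      also have "\<dots> = (\<integral>\<^sup>+x. ennreal (exp (?s * x)) * ennreal (p n x) \<partial>lborel)"
        unfolding q(3) by (subst nn_integral_density) (auto simp: mult.commute)
      also have "\<dots> \<le> ennreal (exp (\<beta> * ?s\<^sup>2 / 2)) * ((\<integral>\<^sup>+x. ennreal ((p n x / std_normal_density x) powr \<alpha> * std_normal_density x) \<partial>lborel) + 1)"
        using mgf_le_of_renyi_integral[OF \<alpha>(1) q(1,2), of ?s] by (simp only: \<alpha>(2))
      also have "\<dots> \<le> ennreal (exp (\<beta> * ?s\<^sup>2 / 2)) * (ennreal (exp (\<alpha> - 1)) + 1)"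
        by (intro mult_left_mono add_right_mono renyi_integral_le_of_divergence_le_1[OF \<alpha>(1) D]) auto
      also have "ennreal (exp (\<alpha> - 1)) + 1 = ennreal C"
        unfolding C_def by (subst ennreal_plus) auto
      also have "ennreal (exp (\<beta> * ?s\<^sup>2 / 2)) * ennreal C = ennreal (C * exp (\<beta> * ?s\<^sup>2 / 2))"
        using C by (simp add: mult.commute flip: ennreal_mult)
      also have "\<beta> * ?s\<^sup>2 / 2 = real n * (\<beta> * t\<^sup>2 / 2)"
        by (simp add: power_mult_distrib)
      finally show "?L ^ n \<le> ennreal (C * exp (real n * (\<beta> * t\<^sup>2 / 2)))" .
    qed
    then show ?thesis by (rule ennreal_le_exp_of_power_le)
  qed
  have "(\<lambda>k. 1 + 1 / real (Suc k)) \<longlonglongrightarrow> 1 + 0"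
    by (intro tendsto_add tendsto_const LIMSEQ_Suc[OF lim_const_over_n])
  then have "(\<lambda>k. exp ((1 + 1 / real (Suc k)) * t\<^sup>2 / 2)) \<longlonglongrightarrow> exp ((1 + 0) * t\<^sup>2 / 2)"
    by (intro tendsto_exp tendsto_divide tendsto_mult tendsto_const) auto
  from tendsto_ennrealI[OF this]
  have "(\<lambda>k. ennreal (exp ((1 + 1 / real (Suc k)) * t\<^sup>2 / 2))) \<longlonglongrightarrow> ennreal (exp (t\<^sup>2 / 2))"
    by simp
  then show ?thesis
    by (rule LIMSEQ_le_const) (intro exI[of _ 0] allI impI \<beta>_bound, simp)
qed

end

section \<open>Densities of sums of strictly subgaussian variables\<close>

text \<open>
  An inequality for densities that holds almost everywhere for each tilt \<open>y\<close> can only be used for countably many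
  \<open>y\<close> simultaneously. This lemma recovers the tilt \<open>y = x / sqrt n\<close>, which depends on \<open>x\<close>, from the
  rational ones.
\<close>

lemma le_at_limit_of_rationals:
  fixes f :: "real \<Rightarrow> real"
  assumes "continuous_on UNIV f" and "open S" "y \<in> S"
    and "\<And>r. r \<in> \<rat> \<Longrightarrow> r \<in> S \<Longrightarrow> a \<le> f r"
  shows "a \<le> f y"
proof (rule ccontr)
  assume "\<not> ?thesis"
  then have "y \<in> S \<inter> f -` {..<a}" using assms(3) by simp
  moreover have "open (S \<inter> f -` {..<a})"
    using assms(1,2) by (intro open_Int open_vimage) auto
  ultimately obtain e where e: "e > 0" "ball y e \<subseteq> S \<inter> f -` {..<a}"
    using open_contains_ball by blast
  obtain r where r: "r \<in> \<rat>" "y < r" "r < y + e"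
    using Rats_dense_in_real[of y "y + e"] e(1) by auto
  then have "r \<in> S \<inter> f -` {..<a}" using e by (intro subsetD[OF e(2)]) (auto simp: dist_real_def)
  then show False using assms(4)[OF r(1)] by auto
qed

locale subgaussian_sums = iid_sums +
  assumes exp_int: "\<And>h. integrable \<nu> (\<lambda>x. exp (h * x))"
    and mgf_le: "\<And>h. mgf \<nu> h \<le> exp (h\<^sup>2 / 2)"
    and mean_int: "integrable \<nu> (\<lambda>x. x)" and mean_zero: "(LINT x|\<nu>. x) = 0"
begin

text \<open>
  Jensen's inequality for a centered law, through \<open>exp u \<ge> 1 + u\<close>.
\<close>

lemma mgf_ge_1: "1 \<le> mgf \<nu> h"
proof -
  have "1 = (LINT x|\<nu>. 1 + h * x)" using mean_int mean_zero by simp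
  also have "\<dots> \<le> (LINT x|\<nu>. exp (h * x))"
    using mean_int exp_int by (intro integral_mono) (auto simp: exp_ge_add_one_self)
  finally show ?thesis by (simp add: mgf_def)
qed

lemma real_distribution_tilt_nu: "real_distribution (tilt \<nu> y)"
  by (rule nu.real_distribution_tilt[OF exp_int])

lemma char_tilt_nu_measurable [measurable]: "char (tilt \<nu> y) \<in> borel_measurable borel"
  using real_distribution_tilt_nu by (rule real_distribution.char_measurable)

text \<open>
  Since \<open>x\<^sup>2 \<le> 2 (exp x + exp (- x))\<close>, the second moment of a tilted law is bounded by values of the moment
  generating function on \<open>[- 2, 2]\<close>.
\<close>

lemma second_moment_tilt_le:
  assumes y: "\<bar>y\<bar> \<le> 1"
  shows "integrable (tilt \<nu> y) (\<lambda>x. x\<^sup>2)" and "(LINT x|tilt \<nu> y. x\<^sup>2) \<le> 4 * exp 2"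
proof -
  have sq: "x\<^sup>2 \<le> 2 * (exp x + exp (- x))" for x :: real
  proof -
    have "1 + \<bar>x\<bar> + \<bar>x\<bar>\<^sup>2 / 2 \<le> exp \<bar>x\<bar>" by (rule exp_lower_Taylor_quadratic) simp
    moreover have "exp \<bar>x\<bar> \<le> exp x + exp (- x)" by (cases "x \<ge> 0") auto
    ultimately show ?thesis by simp
  qed
  have bound: "exp (y * x) * x\<^sup>2 \<le> 2 * (exp ((y + 1) * x) + exp ((y - 1) * x))" for x
  proof -
    have "exp ((y + 1) * x) = exp (y * x) * exp x" "exp ((y - 1) * x) = exp (y * x) * exp (- x)"
      by (simp_all add: algebra_simps flip: exp_add)
    then show ?thesis
      using mult_left_mono[OF sq[of x], of "exp (y * x)"] by (simp only: distrib_left mult.left_commute) simp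
  qed
  have int: "integrable \<nu> (\<lambda>x. exp (y * x) *\<^sub>R x\<^sup>2)"
  proof (rule Bochner_Integration.integrable_bound)
    show "integrable \<nu> (\<lambda>x. 2 * (exp ((y + 1) * x) + exp ((y - 1) * x)))" using exp_int by auto
  qed (use bound in \<open>auto intro!: AE_I2\<close>)
  then show "integrable (tilt \<nu> y) (\<lambda>x. x\<^sup>2)" by (subst nu.integral_tilt(2)[OF exp_int]) auto
  have E: "mgf \<nu> h \<le> exp 2" if "\<bar>h\<bar> \<le> 2" for h
  proof -
    have "h\<^sup>2 \<le> 2\<^sup>2" using that abs_le_square_iff[of h 2] by simp
    then have "exp (h\<^sup>2 / 2) \<le> exp 2" by simp
    with mgf_le[of h] show ?thesis by (rule order_trans)
  qed
  have nonneg: "0 \<le> (LINT x|\<nu>. exp (y * x) *\<^sub>R x\<^sup>2)" by (auto intro!: integral_nonneg_AE)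
  have "(LINT x|tilt \<nu> y. x\<^sup>2) = (LINT x|\<nu>. exp (y * x) *\<^sub>R x\<^sup>2) / mgf \<nu> y"
    by (subst nu.integral_tilt(1)[OF exp_int]) (auto simp: divide_inverse mult.commute)
  also have "\<dots> \<le> (LINT x|\<nu>. exp (y * x) *\<^sub>R x\<^sup>2)"
    using divide_left_mono[OF mgf_ge_1[of y] nonneg] mgf_ge_1[of y] by simp
  also have "\<dots> \<le> (LINT x|\<nu>. 2 * (exp ((y + 1) * x) + exp ((y - 1) * x)))"
    using int exp_int bound by (intro integral_mono) auto
  also have "\<dots> = 2 * (mgf \<nu> (y + 1) + mgf \<nu> (y - 1))"
    using exp_int by (simp add: mgf_def)
  also have "\<dots> \<le> 4 * exp 2"
    using E[of "y + 1"] E[of "y - 1"] y by (simp add: abs_le_iff)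
  finally show "(LINT x|tilt \<nu> y. x\<^sup>2) \<le> 4 * exp 2" .
qed

lemma tilted_density:
  fixes y t :: real
  assumes n: "n \<ge> 1" and q: "has_density M (normalized_sum Xs n) q"
  defines "h \<equiv> sqrt (real n) * y"
  shows "1 \<le> mgf (sum_law n) h" "mgf (sum_law n) h \<le> exp (real n * y\<^sup>2 / 2)"
    "tilt (sum_law n) h = density lborel (\<lambda>x. ennreal (q x * exp (h * x) / mgf (sum_law n) h))"
    "real_distribution (tilt (sum_law n) h)"
    "char (tilt (sum_law n) h) t = char (tilt \<nu> y) (t / sqrt (real n)) ^ n"
proof -
  have hy: "h / sqrt (real n) = y" using n by (simp add: h_def)
  have m: "mgf (sum_law n) h = mgf \<nu> y ^ n"
    using mgf_sum_law[of h n] exp_int by (simp add: hy)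
  show ge1: "1 \<le> mgf (sum_law n) h" unfolding m using mgf_ge_1 by (rule one_le_power)
  have "mgf \<nu> y ^ n \<le> exp (y\<^sup>2 / 2) ^ n"
    using mgf_le mgf_ge_1[of y] by (intro power_mono) auto
  then show "mgf (sum_law n) h \<le> exp (real n * y\<^sup>2 / 2)"
    unfolding m by (simp flip: exp_of_nat_mult)
  show "tilt (sum_law n) h = density lborel (\<lambda>x. ennreal (q x * exp (h * x) / mgf (sum_law n) h))"
    using ge1 sum_law_density[OF q] by (simp add: tilt_density)
  show "real_distribution (tilt (sum_law n) h)"
  proof (intro real_distribution.real_distribution_tilt real_distribution_sum_law)
    have "integrable (sum_law n) (\<lambda>x. exp (Re (complex_of_real h) * x))"
      by (intro cmgf_sum_law(1) exp_int)
    then show "integrable (sum_law n) (\<lambda>x. exp (h * x))" by simp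
  qed
  show "char (tilt (sum_law n) h) t = char (tilt \<nu> y) (t / sqrt (real n)) ^ n"
    using char_tilt_sum_law[of h n t] exp_int by (simp add: hy)
qed

text \<open>
  Parseval's inequality for the law of the normalized sum tilted by \<open>h = y sqrt n\<close>. Its density
  squared carries the factor \<open>exp (2 h x)\<close>, and \<open>2 h x \<le> x\<^sup>2 / 2 + 2 h\<^sup>2\<close> compares it with the weight in
  \<open>A\<close>.
\<close>

lemma nn_integral_char_tilt_le:
  assumes n: "n \<ge> 1" and q: "has_density M (normalized_sum Xs n) q"
    and A: "A \<ge> 0" "(\<integral>\<^sup>+x. ennreal ((q x)\<^sup>2 * exp (x\<^sup>2 / 2)) \<partial>lborel) \<le> ennreal A"
  shows "(\<integral>\<^sup>+t. ennreal (norm (char (tilt \<nu> y) t) ^ (2 * n)) \<partial>lborel) \<le> ennreal (2 * pi * A * exp (2 * real n * y\<^sup>2))"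
proof -
  define h where "h = sqrt (real n) * y"
  define m where "m = mgf (sum_law n) h"
  note td = tilted_density[OF n q, of y, folded h_def]
  have [measurable]: "q \<in> borel_measurable borel" and q0: "\<And>x. 0 \<le> q x"
    using sum_law_density[OF q] by auto
  let ?r = "\<lambda>x. q x * exp (h * x) / m"
  have m: "m \<ge> 1" using td(1) by (simp add: m_def)
  have tl: "tilt (sum_law n) h = density lborel (\<lambda>x. ennreal (?r x))" using td(3) by (simp add: m_def)
  have "(\<integral>\<^sup>+t. ennreal (norm (char (tilt \<nu> y) t) ^ (2 * n)) \<partial>lborel)
      = ennreal \<bar>1 / sqrt (real n)\<bar> * (\<integral>\<^sup>+t. ennreal (norm (char (tilt \<nu> y) (0 + 1 / sqrt (real n) * t)) ^ (2 * n)) \<partial>lborel)"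
    using n by (intro nn_integral_real_affine) auto
  also have "\<dots> \<le> 1 * (\<integral>\<^sup>+t. ennreal (norm (char (tilt \<nu> y) (0 + 1 / sqrt (real n) * t)) ^ (2 * n)) \<partial>lborel)"
    using n by (intro mult_right_mono) (auto simp: ennreal_le_1)
  also have "\<dots> = (\<integral>\<^sup>+t. ennreal ((norm (char (tilt (sum_law n) h) t))\<^sup>2) \<partial>lborel)"
    unfolding td(5) by (simp add: norm_power power_mult[symmetric] mult.commute)
  also have "\<dots> \<le> ennreal (2 * pi) * (\<integral>\<^sup>+x. ennreal ((?r x)\<^sup>2) \<partial>lborel)"
    unfolding tl using m q0 td(4)[unfolded tl] by (intro nn_integral_norm_char_squared_le) auto
  also have "(\<integral>\<^sup>+x. ennreal ((?r x)\<^sup>2) \<partial>lborel) \<le> (\<integral>\<^sup>+x. ennreal (exp (2 * real n * y\<^sup>2)) * ennreal ((q x)\<^sup>2 * exp (x\<^sup>2 / 2)) \<partial>lborel)"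
  proof (rule nn_integral_mono)
    fix x
    have "?r x \<le> q x * exp (h * x) / 1"
      using m q0[of x] by (intro divide_left_mono) auto
    then have "(?r x)\<^sup>2 \<le> (q x * exp (h * x))\<^sup>2"
      using m q0[of x] by (intro power_mono) auto
    also have "\<dots> = (q x)\<^sup>2 * exp (2 * h * x)"
      by (simp add: power_mult_distrib exp_double[symmetric] ac_simps)
    also have "\<dots> \<le> (q x)\<^sup>2 * exp (2 * h\<^sup>2 + x\<^sup>2 / 2)"
      using zero_le_power2[of "2 * h - x"] by (intro mult_left_mono) (simp_all add: power2_eq_square algebra_simps)
    also have "\<dots> = exp (2 * real n * y\<^sup>2) * ((q x)\<^sup>2 * exp (x\<^sup>2 / 2))"
      by (simp add: h_def power_mult_distrib exp_add)
    finally show "ennreal ((?r x)\<^sup>2) \<le> ennreal (exp (2 * real n * y\<^sup>2)) * ennreal ((q x)\<^sup>2 * exp (x\<^sup>2 / 2))"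
      by (subst ennreal_mult[symmetric]) (auto intro: ennreal_leI)
  qed
  also have "\<dots> = ennreal (exp (2 * real n * y\<^sup>2)) * (\<integral>\<^sup>+x. ennreal ((q x)\<^sup>2 * exp (x\<^sup>2 / 2)) \<partial>lborel)"
    by (rule nn_integral_cmult) simp
  also have "ennreal (2 * pi) * \<dots> \<le> ennreal (2 * pi) * (ennreal (exp (2 * real n * y\<^sup>2)) * ennreal A)"
    by (intro mult_left_mono A) auto
  also have "\<dots> = ennreal (2 * pi * A * exp (2 * real n * y\<^sup>2))"
    using A by (simp add: ac_simps flip: ennreal_mult)
  finally show ?thesis by (simp add: mult_left_mono)
qed

text \<open>
  Fourier inversion bounds the tilted density by the \<open>L\<^sup>1\<close> norm of its characteristic function.
  Undoing the tilt multiplies by \<open>L(y) ^ n exp (- h x)\<close>, and this is where subgaussianity enters.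
\<close>

lemma density_le_nn_integral_char_tilt:
  assumes n: "n \<ge> 1" and q: "has_density M (normalized_sum Xs n) q"
    and J: "J \<ge> 0" "(\<integral>\<^sup>+t. ennreal (norm (char (tilt \<nu> y) t) ^ n) \<partial>lborel) \<le> ennreal J"
  shows "AE x in lborel. q x \<le> exp (real n * y\<^sup>2 / 2 - sqrt (real n) * y * x) * sqrt (real n) * J"
proof -
  define h where "h = sqrt (real n) * y"
  define m where "m = mgf (sum_law n) h"
  note td = tilted_density[OF n q, of y, folded h_def]
  have qm[measurable]: "q \<in> borel_measurable borel" and q0: "\<And>x. 0 \<le> q x"
    using sum_law_density[OF q] by auto
  let ?r = "\<lambda>x. q x * exp (h * x) / m"
  let ?D = "density lborel (\<lambda>x. ennreal (?r x))"
  have m: "m \<ge> 1" using td(1) by (simp add: m_def)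
  have tl: "tilt (sum_law n) h = ?D" using td(3) by (simp add: m_def)
  interpret D: real_distribution ?D using td(4) unfolding tl .
  have [measurable]: "char ?D \<in> borel_measurable borel" by auto
  have "(\<integral>\<^sup>+t. ennreal (norm (char (tilt \<nu> y) t) ^ n) \<partial>lborel)
      = ennreal \<bar>1 / sqrt (real n)\<bar> * (\<integral>\<^sup>+t. ennreal (norm (char (tilt \<nu> y) (0 + 1 / sqrt (real n) * t)) ^ n) \<partial>lborel)"
    using n by (intro nn_integral_real_affine) auto
  also have "(\<lambda>t. ennreal (norm (char (tilt \<nu> y) (0 + 1 / sqrt (real n) * t)) ^ n)) = (\<lambda>t. ennreal (norm (char ?D t)))"
    unfolding tl[symmetric] td(5) by (simp add: norm_power)
  finally have e1: "ennreal \<bar>1 / sqrt (real n)\<bar> * (\<integral>\<^sup>+t. ennreal (norm (char ?D t)) \<partial>lborel) \<le> ennreal J"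
    using J by simp
  have "(\<integral>\<^sup>+t. ennreal (norm (char ?D t)) \<partial>lborel)
      = ennreal (sqrt (real n)) * (ennreal \<bar>1 / sqrt (real n)\<bar> * (\<integral>\<^sup>+t. ennreal (norm (char ?D t)) \<partial>lborel))"
    unfolding mult.assoc[symmetric] using n by (subst ennreal_mult[symmetric]) auto
  also have "\<dots> \<le> ennreal (sqrt (real n)) * ennreal J" by (intro mult_left_mono e1) simp
  finally have e2: "(\<integral>\<^sup>+t. ennreal (norm (char ?D t)) \<partial>lborel) \<le> ennreal (sqrt (real n) * J)"
    using J by (simp add: ennreal_mult)
  have int: "integrable lborel (char ?D)"
    using e2 by (intro integrableI_bounded) (auto intro: le_less_trans)
  have e3: "(LINT t|lborel. norm (char ?D t)) \<le> sqrt (real n) * J"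
    using e2 J nn_integral_eq_integral[OF integrable_norm[OF int]] by (simp add: ennreal_le_iff)
  have "AE x in lborel. ?r x = Re (CLINT t|lborel. iexp (- (t * x)) * char ?D t) / (2 * pi)"
    using q0 m by (intro fourier_inversion_AE int D.real_distribution_axioms) auto
  then show ?thesis
  proof eventually_elim
    fix x assume eq: "?r x = Re (CLINT t|lborel. iexp (- (t * x)) * char ?D t) / (2 * pi)"
    have "Re (CLINT t|lborel. iexp (- (t * x)) * char ?D t) \<le> norm (CLINT t|lborel. iexp (- (t * x)) * char ?D t)"
      by (rule complex_Re_le_cmod)
    also have "\<dots> \<le> (LINT t|lborel. norm (iexp (- (t * x)) * char ?D t))" by (rule integral_norm_bound)
    also have "\<dots> = (LINT t|lborel. norm (char ?D t))" by (simp add: norm_mult del: of_real_mult of_real_minus)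
    also note e3
    finally have "Re (CLINT t|lborel. iexp (- (t * x)) * char ?D t) \<le> sqrt (real n) * J" .
    then have "?r x \<le> sqrt (real n) * J / (2 * pi)"
      unfolding eq by (intro divide_right_mono) auto
    also have "\<dots> \<le> sqrt (real n) * J / 1"
      using J pi_ge_two by (intro divide_left_mono) auto
    finally have "q x * exp (h * x) \<le> m * (sqrt (real n) * J)"
      using m by (simp add: field_simps)
    also have "\<dots> \<le> exp (real n * y\<^sup>2 / 2) * (sqrt (real n) * J)"
      using td(2) J by (intro mult_right_mono) (auto simp: m_def)
    finally have "q x * exp (h * x) * exp (- (h * x)) \<le> exp (real n * y\<^sup>2 / 2) * (sqrt (real n) * J) * exp (- (h * x))"
      by (intro mult_right_mono) auto
    also have "q x * exp (h * x) * exp (- (h * x)) = q x"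
      by (simp add: exp_minus)
    also have "exp (real n * y\<^sup>2 / 2) * (sqrt (real n) * J) * exp (- (h * x))
        = (exp (real n * y\<^sup>2 / 2) * exp (- (h * x))) * sqrt (real n) * J"
      by (simp only: ac_simps)
    also have "exp (real n * y\<^sup>2 / 2) * exp (- (h * x)) = exp (real n * y\<^sup>2 / 2 - sqrt (real n) * y * x)"
      by (simp add: h_def flip: exp_add)
    finally show "q x \<le> exp (real n * y\<^sup>2 / 2 - sqrt (real n) * y * x) * sqrt (real n) * J" .
  qed
qed

end

section \<open>Gaussian domination of the densities\<close>

text \<open>
  The bound \<open>A\<close> expresses that \<open>D\<^sub>2\<close> is finite at the index \<open>n0\<close>: up to the factor \<open>sqrt (2 \<pi>)\<close>, the integral is
  that of \<open>(p / \<phi>)\<^sup>2 \<phi>\<close>.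
\<close>

locale renyi_sums = subgaussian_sums +
  fixes p :: "nat \<Rightarrow> real \<Rightarrow> real" and n0 :: nat and A :: real
  assumes n0: "n0 \<ge> 1" and A: "A \<ge> 0"
    and dens0: "has_density M (normalized_sum Xs n0) (p n0)"
    and A_bound: "(\<integral>\<^sup>+x. ennreal ((p n0 x)\<^sup>2 * exp (x\<^sup>2 / 2)) \<partial>lborel) \<le> ennreal A"
    and var_int: "integrable \<nu> (\<lambda>x. x\<^sup>2)" and var_one: "(LINT x|\<nu>. x\<^sup>2) = 1"
begin

lemma norm_char_tilt_le_1: "norm (char (tilt \<nu> y) t) \<le> 1"
  using real_distribution_tilt_nu by (rule real_distribution.cmod_char_le_1)

lemma char_power_integral_base:
  "(\<integral>\<^sup>+t. ennreal (norm (char (tilt \<nu> y) t) ^ (2 * n0)) \<partial>lborel) \<le> ennreal (2 * pi * A * exp (2 * real n0 * y\<^sup>2))"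
  by (rule nn_integral_char_tilt_le[OF n0 dens0 A A_bound])

lemma char_power_integral_unit:
  assumes y: "\<bar>y\<bar> \<le> 1"
  shows "(\<integral>\<^sup>+t. ennreal (norm (char (tilt \<nu> y) t) ^ (2 * n0)) \<partial>lborel) \<le> ennreal (2 * pi * A * exp (2 * real n0))"
proof (rule order_trans[OF char_power_integral_base ennreal_leI])
  have "y\<^sup>2 \<le> 1" using y abs_square_le_1 by blast
  then have "2 * real n0 * y\<^sup>2 \<le> 2 * real n0 * 1" by (intro mult_left_mono) auto
  then show "2 * pi * A * exp (2 * real n0 * y\<^sup>2) \<le> 2 * pi * A * exp (2 * real n0)"
    using A by (intro mult_left_mono) auto
qed

lemma char_power_integral_le:
  assumes "n \<ge> 2 * n0"
  shows "(\<integral>\<^sup>+t. ennreal (norm (char (tilt \<nu> y) t) ^ n) \<partial>lborel) \<le> ennreal (2 * pi * A * exp (2 * real n0 * y\<^sup>2))"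
proof -
  have "(\<integral>\<^sup>+t. ennreal (norm (char (tilt \<nu> y) t) ^ n) \<partial>lborel)
      \<le> (\<integral>\<^sup>+t. ennreal (norm (char (tilt \<nu> y) t) ^ (2 * n0)) \<partial>lborel)"
    using assms norm_char_tilt_le_1 by (intro nn_integral_mono ennreal_leI power_decreasing) auto
  then show ?thesis using char_power_integral_base by (rule order_trans)
qed

lemma char_tilt_gap:
  "\<exists>c>0. \<forall>y t. \<bar>y\<bar> \<le> 1 \<longrightarrow> norm (char (tilt \<nu> y) t) \<le> 1 - c * min 1 (t\<^sup>2)"
proof -
  obtain c where c: "c > 0" and *: "\<And>M t. real_distribution M \<Longrightarrow> integrable M (\<lambda>x. x\<^sup>2) \<Longrightarrow> (\<integral>x. x\<^sup>2 \<partial>M) \<le> 4 * exp 2 \<Longrightarrow>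
           (\<integral>\<^sup>+t. ennreal (norm (char M t) ^ (2 * n0)) \<partial>lborel) \<le> ennreal (2 * pi * A * exp (2 * real n0)) \<Longrightarrow>
           norm (char M t) \<le> 1 - c * min 1 (t\<^sup>2)"
    using uniform_char_gap[of "4 * exp 2" "2 * pi * A * exp (2 * real n0)" "2 * n0"] A by auto
  have "norm (char (tilt \<nu> y) t) \<le> 1 - c * min 1 (t\<^sup>2)" if y: "\<bar>y\<bar> \<le> 1" for y t
    by (rule *[OF real_distribution_tilt_nu second_moment_tilt_le[OF y] char_power_integral_unit[OF y]])
  then show ?thesis using c by blast
qed

text \<open>
  The rate \<open>1 / n\<close> is all that is needed of the exponentially small factor: it beats the \<open>sqrt n\<close> that
  the change of scale costs.
\<close>

lemma exp_decay_le:
  assumes "c > 0" "n \<ge> 2 * n0"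
  shows "exp (- (c * real (n - 2 * n0))) \<le> exp (2 * c * real n0) / (c * real n)"
proof -
  have npos: "real n > 0" using assms n0 by simp
  have "c * real n \<le> exp (c * real n)" using exp_ge_add_one_self[of "c * real n"] by linarith
  then have "exp (- (c * real n)) \<le> 1 / (c * real n)"
    using assms npos by (simp add: exp_minus field_simps)
  then have "exp (2 * c * real n0) * exp (- (c * real n)) \<le> exp (2 * c * real n0) * (1 / (c * real n))"
    by (intro mult_left_mono) auto
  then show ?thesis using assms by (simp add: of_nat_diff algebra_simps flip: exp_add)
qed

text \<open>
  For \<open>|y| \<le> 1\<close> the gap is uniform in \<open>y\<close>, so the integral has the order \<open>1 / sqrt n\<close> of
  \<open>\<integral> exp (- c n t\<^sup>2)\<close>.
\<close>

lemma char_power_integral_small_tilt: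
  "\<exists>C\<ge>0. \<forall>y n. \<bar>y\<bar> \<le> 1 \<longrightarrow> n \<ge> 2 * n0 \<longrightarrow>
     (\<integral>\<^sup>+t. ennreal (norm (char (tilt \<nu> y) t) ^ n) \<partial>lborel) \<le> ennreal (C / sqrt (real n))"
proof -
  obtain c where c: "c > 0" and gap: "\<And>y t. \<bar>y\<bar> \<le> 1 \<Longrightarrow> norm (char (tilt \<nu> y) t) \<le> 1 - c * min 1 (t\<^sup>2)"
    using char_tilt_gap by blast
  define J where "J = 2 * pi * A * exp (2 * real n0)"
  have J: "J \<ge> 0" using A by (simp add: J_def)
  define C where "C = sqrt (pi / c) + exp (2 * c * real n0) / c * J"
  have "(\<integral>\<^sup>+t. ennreal (norm (char (tilt \<nu> y) t) ^ n) \<partial>lborel) \<le> ennreal (C / sqrt (real n))"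
    if y: "\<bar>y\<bar> \<le> 1" and n: "n \<ge> 2 * n0" for y n
  proof -
    have n1: "real n \<ge> 1" using n n0 by simp
    have Jy: "(\<integral>\<^sup>+t. ennreal (norm (char (tilt \<nu> y) t) ^ (2 * n0)) \<partial>lborel) \<le> ennreal J"
      unfolding J_def by (rule char_power_integral_unit[OF y])
    let ?E = "exp (- (c * real (n - 2 * n0)))"
    have "(\<integral>\<^sup>+t. ennreal (norm (char (tilt \<nu> y) t) ^ n) \<partial>lborel)
       \<le> (\<integral>\<^sup>+t. ennreal (exp (- (c * real n * t\<^sup>2))) + ennreal ?E * ennreal (norm (char (tilt \<nu> y) t) ^ (2 * n0)) \<partial>lborel)"
    proof (rule nn_integral_mono)
      fix t
      have "norm (char (tilt \<nu> y) t) ^ n \<le> exp (- (c * real n * t\<^sup>2)) + ?E * norm (char (tilt \<nu> y) t) ^ (2 * n0)"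
        using n c gap[OF y] norm_char_tilt_le_1 by (intro power_le_gauss_plus_tail) auto
      then show "ennreal (norm (char (tilt \<nu> y) t) ^ n) \<le> ennreal (exp (- (c * real n * t\<^sup>2))) + ennreal ?E * ennreal (norm (char (tilt \<nu> y) t) ^ (2 * n0))"
        by (simp add: ennreal_leI flip: ennreal_mult ennreal_plus)
    qed
    also have "\<dots> = ennreal (sqrt (pi / (c * real n))) + ennreal ?E * (\<integral>\<^sup>+t. ennreal (norm (char (tilt \<nu> y) t) ^ (2 * n0)) \<partial>lborel)"
      using c n1 by (subst nn_integral_add) (auto simp: nn_integral_cmult nn_integral_exp_neg_square)
    also have "\<dots> \<le> ennreal (sqrt (pi / (c * real n))) + ennreal ?E * ennreal J"
      by (intro add_left_mono mult_left_mono Jy) auto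
    also have "\<dots> = ennreal (sqrt (pi / (c * real n)) + ?E * J)"
      using J c n1 by (simp flip: ennreal_mult ennreal_plus)
    also have "\<dots> \<le> ennreal (C / sqrt (real n))"
    proof (rule ennreal_leI)
      have "sqrt (real n) \<le> real n"
        using n1 real_sqrt_le_mono[of "real n" "(real n)\<^sup>2"] self_le_power[of "real n" 2] by simp
      then have "1 / (c * real n) \<le> 1 / (c * sqrt (real n))"
        using c n1 by (intro divide_left_mono mult_left_mono) auto
      then have "exp (2 * c * real n0) * (1 / (c * real n)) \<le> exp (2 * c * real n0) * (1 / (c * sqrt (real n)))"
        by (intro mult_left_mono) auto
      then have "?E \<le> exp (2 * c * real n0) / (c * sqrt (real n))"
        using exp_decay_le[OF c n] by simp
      then have "?E * J \<le> exp (2 * c * real n0) / (c * sqrt (real n)) * J"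
        using J by (intro mult_right_mono)
      moreover have "sqrt (pi / (c * real n)) = sqrt (pi / c) / sqrt (real n)"
        by (simp add: real_sqrt_divide real_sqrt_mult)
      ultimately show "sqrt (pi / (c * real n)) + ?E * J \<le> C / sqrt (real n)"
        by (simp add: C_def add_divide_distrib)
    qed
    finally show ?thesis .
  qed
  moreover have "C \<ge> 0" using c J by (simp add: C_def)
  ultimately show ?thesis by blast
qed

text \<open>
  Both bounds use the tilt \<open>y = x / sqrt n\<close>, for which \<open>n y\<^sup>2 / 2 - y x sqrt n = - x\<^sup>2 / 2\<close>. The first one is
  valid for all \<open>x\<close> but loses \<open>sqrt n\<close>. The second one, for \<open>|y| < 1\<close>, does not.
\<close>

lemma density_two_bounds:
  assumes C: "C \<ge> 0" "\<And>y n. \<bar>y\<bar> \<le> 1 \<Longrightarrow> n \<ge> 2 * n0 \<Longrightarrow>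
     (\<integral>\<^sup>+t. ennreal (norm (char (tilt \<nu> y) t) ^ n) \<partial>lborel) \<le> ennreal (C / sqrt (real n))"
    and n: "n \<ge> 2 * n0" and dens: "has_density M (normalized_sum Xs n) (p n)"
  shows "AE x in lborel. p n x \<le> sqrt (real n) * (2 * pi * A * exp (2 * real n0 * x\<^sup>2 / real n)) * exp (- x\<^sup>2 / 2)
      \<and> (\<bar>x\<bar> < sqrt (real n) \<longrightarrow> p n x \<le> C * exp (- x\<^sup>2 / 2))"
proof -
  have n1: "n \<ge> 1" using n n0 by simp
  let ?e = "\<lambda>x y. exp (real n * y\<^sup>2 / 2 - sqrt (real n) * y * x)"
  have "AE x in lborel. \<forall>y\<in>\<rat>. p n x \<le> ?e x y * sqrt (real n) * (2 * pi * A * exp (2 * real n0 * y\<^sup>2))"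
    using A by (intro AE_ball_countable' countable_rat density_le_nn_integral_char_tilt n1 dens char_power_integral_le n) auto
  moreover have "AE x in lborel. \<forall>y\<in>\<rat>. y \<in> {-1<..<1} \<longrightarrow> p n x \<le> ?e x y * sqrt (real n) * (C / sqrt (real n))"
  proof (intro AE_ball_countable' countable_rat)
    fix y :: real
    have "AE x in lborel. p n x \<le> ?e x y * sqrt (real n) * (C / sqrt (real n))" if "y \<in> {-1<..<1}"
      using C n that by (intro density_le_nn_integral_char_tilt n1 dens) auto
    then show "AE x in lborel. y \<in> {-1<..<1} \<longrightarrow> p n x \<le> ?e x y * sqrt (real n) * (C / sqrt (real n))"
      by auto
  qed
  ultimately show ?thesis
  proof eventually_elim
    fix x
    assume a: "\<forall>y\<in>\<rat>. p n x \<le> ?e x y * sqrt (real n) * (2 * pi * A * exp (2 * real n0 * y\<^sup>2))"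
      and b: "\<forall>y\<in>\<rat>. y \<in> {-1<..<1} \<longrightarrow> p n x \<le> ?e x y * sqrt (real n) * (C / sqrt (real n))"
    let ?y = "x / sqrt (real n)"
    have y2: "?y\<^sup>2 = x\<^sup>2 / real n" by (simp add: power_divide)
    have e: "?e x ?y = exp (- x\<^sup>2 / 2)"
    proof -
      have "real n * (x\<^sup>2 / real n) = x\<^sup>2" "sqrt (real n) * ?y = x" using n1 by auto
      then have "real n * ?y\<^sup>2 / 2 - sqrt (real n) * ?y * x = x\<^sup>2 / 2 - x * x"
        unfolding y2 by (simp only:)
      also have "\<dots> = - x\<^sup>2 / 2" by (simp add: power2_eq_square)
      finally show ?thesis by (simp only:)
    qed
    have "p n x \<le> ?e x ?y * sqrt (real n) * (2 * pi * A * exp (2 * real n0 * ?y\<^sup>2))"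
    proof (rule le_at_limit_of_rationals[where S=UNIV and f="\<lambda>y. ?e x y * sqrt (real n) * (2 * pi * A * exp (2 * real n0 * y\<^sup>2))"])
      show "continuous_on UNIV (\<lambda>y. ?e x y * sqrt (real n) * (2 * pi * A * exp (2 * real n0 * y\<^sup>2)))"
        by (intro continuous_intros) simp_all
    qed (use a in \<open>blast+\<close>)
    then have "p n x \<le> sqrt (real n) * (2 * pi * A * exp (2 * real n0 * x\<^sup>2 / real n)) * exp (- x\<^sup>2 / 2)"
      unfolding e by (simp add: y2 ac_simps)
    moreover have "p n x \<le> C * exp (- x\<^sup>2 / 2)" if x: "\<bar>x\<bar> < sqrt (real n)"
    proof -
      have "p n x \<le> ?e x ?y * sqrt (real n) * (C / sqrt (real n))"
      proof (rule le_at_limit_of_rationals[where S="{-1<..<1}" and f="\<lambda>y. ?e x y * sqrt (real n) * (C / sqrt (real n))"])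
        show "?y \<in> {-1<..<1}" using x n1 by (auto simp: abs_less_iff field_simps)
        show "continuous_on UNIV (\<lambda>y. ?e x y * sqrt (real n) * (C / sqrt (real n)))"
          by (intro continuous_intros) simp_all
      qed (use b in \<open>simp, blast\<close>)
      then show ?thesis unfolding e using n1 by (simp add: ac_simps)
    qed
    ultimately show "p n x \<le> sqrt (real n) * (2 * pi * A * exp (2 * real n0 * x\<^sup>2 / real n)) * exp (- x\<^sup>2 / 2)
      \<and> (\<bar>x\<bar> < sqrt (real n) \<longrightarrow> p n x \<le> C * exp (- x\<^sup>2 / 2))" by blast
  qed
qed

text \<open>
  In the outer range \<open>sqrt n \<le> |x|\<close> the lost factor \<open>sqrt n\<close> is at most \<open>|x|\<close>, and both it and
  \<open>exp (2 n\<^sub>0 x\<^sup>2 / n)\<close> are absorbed by \<open>exp (\<epsilon> x\<^sup>2 / 2)\<close> once \<open>n \<ge> 4 n\<^sub>0 / \<epsilon>\<close>.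
\<close>

lemma density_domination:
  assumes eps: "\<epsilon> > 0" and dens: "\<forall>\<^sub>F n in sequentially. has_density M (normalized_sum Xs n) (p n)"
  shows "\<exists>K. \<forall>\<^sub>F n in sequentially. AE x in lborel. p n x \<le> K * exp (\<epsilon> * x\<^sup>2) * std_normal_density x"
proof -
  obtain C where C: "C \<ge> 0" "\<And>y n. \<bar>y\<bar> \<le> 1 \<Longrightarrow> n \<ge> 2 * n0 \<Longrightarrow>
     (\<integral>\<^sup>+t. ennreal (norm (char (tilt \<nu> y) t) ^ n) \<partial>lborel) \<le> ennreal (C / sqrt (real n))"
    using char_power_integral_small_tilt by blast
  define D where "D = 2 * pi * A"
  define K where "K = C + D * (1 + 2 / \<epsilon>)"
  have D: "D \<ge> 0" using A by (simp add: D_def)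
  then have DK: "D * (1 + 2 / \<epsilon>) \<ge> 0" using eps by simp
  obtain N where N: "real N \<ge> 4 * real n0 / \<epsilon>" using real_arch_simple by blast
  have "\<forall>\<^sub>F n in sequentially. AE x in lborel. p n x \<le> sqrt (2 * pi) * K * exp (\<epsilon> * x\<^sup>2) * std_normal_density x"
    using dens eventually_ge_at_top[of "2 * n0"] eventually_ge_at_top[of N]
  proof eventually_elim
    fix n assume d: "has_density M (normalized_sum Xs n) (p n)" and n: "2 * n0 \<le> n" and nN: "N \<le> n"
    have n1: "real n \<ge> 1" using n n0 by simp
    have ratio: "2 * real n0 / real n \<le> \<epsilon> / 2"
    proof -
      have "4 * real n0 / \<epsilon> \<le> real n" using N nN by simp
      then show ?thesis using eps n1 by (simp add: field_simps)
    qed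
    have "AE x in lborel. p n x \<le> sqrt (real n) * (2 * pi * A * exp (2 * real n0 * x\<^sup>2 / real n)) * exp (- x\<^sup>2 / 2)
      \<and> (\<bar>x\<bar> < sqrt (real n) \<longrightarrow> p n x \<le> C * exp (- x\<^sup>2 / 2))"
      by (rule density_two_bounds[OF C n d]) auto
    then show "AE x in lborel. p n x \<le> sqrt (2 * pi) * K * exp (\<epsilon> * x\<^sup>2) * std_normal_density x"
    proof eventually_elim
      fix x assume b: "p n x \<le> sqrt (real n) * (2 * pi * A * exp (2 * real n0 * x\<^sup>2 / real n)) * exp (- x\<^sup>2 / 2)
      \<and> (\<bar>x\<bar> < sqrt (real n) \<longrightarrow> p n x \<le> C * exp (- x\<^sup>2 / 2))"
      have "p n x \<le> K * exp (\<epsilon> * x\<^sup>2) * exp (- x\<^sup>2 / 2)"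
      proof (cases "\<bar>x\<bar> < sqrt (real n)")
        case True
        then have "p n x \<le> C * exp (- x\<^sup>2 / 2)" using b by blast
        also have "\<dots> \<le> K * exp (\<epsilon> * x\<^sup>2) * exp (- x\<^sup>2 / 2)"
        proof (rule mult_right_mono)
          have "C * 1 \<le> K * exp (\<epsilon> * x\<^sup>2)"
            using C(1) DK eps by (intro mult_mono) (auto simp: K_def)
          then show "C \<le> K * exp (\<epsilon> * x\<^sup>2)" by simp
        qed simp
        finally show ?thesis .
      next
        case False
        have "x\<^sup>2 * (2 * real n0 / real n) \<le> x\<^sup>2 * (\<epsilon> / 2)" by (intro mult_left_mono ratio) simp
        then have e1: "exp (2 * real n0 * x\<^sup>2 / real n) \<le> exp (\<epsilon> / 2 * x\<^sup>2)" by (simp add: ac_simps)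
        \<comment> \<open>A polynomial factor is absorbed through \<open>1 + z \<le> exp z\<close>.\<close>
        have "\<bar>x\<bar> \<le> 1 + x\<^sup>2" using zero_le_power2[of "\<bar>x\<bar> - 1"] abs_ge_zero[of x] by (simp add: power2_diff) 
        also have "\<dots> \<le> (1 + 2 / \<epsilon>) * (1 + \<epsilon> / 2 * x\<^sup>2)"
          using eps by (simp add: field_simps)
        also have "\<dots> \<le> (1 + 2 / \<epsilon>) * exp (\<epsilon> / 2 * x\<^sup>2)"
          using eps by (intro mult_left_mono exp_ge_add_one_self) auto
        finally have e2: "sqrt (real n) \<le> (1 + 2 / \<epsilon>) * exp (\<epsilon> / 2 * x\<^sup>2)" using False by simp
        have "p n x \<le> sqrt (real n) * (D * exp (2 * real n0 * x\<^sup>2 / real n)) * exp (- x\<^sup>2 / 2)"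
          using b by (simp add: D_def)
        also have "\<dots> \<le> ((1 + 2 / \<epsilon>) * exp (\<epsilon> / 2 * x\<^sup>2)) * (D * exp (\<epsilon> / 2 * x\<^sup>2)) * exp (- x\<^sup>2 / 2)"
          using e1 e2 D eps by (intro mult_right_mono mult_mono mult_left_mono) auto
        also have "\<dots> = D * (1 + 2 / \<epsilon>) * (exp (\<epsilon> / 2 * x\<^sup>2) * exp (\<epsilon> / 2 * x\<^sup>2)) * exp (- x\<^sup>2 / 2)"
          by (simp only: ac_simps)
        also have "exp (\<epsilon> / 2 * x\<^sup>2) * exp (\<epsilon> / 2 * x\<^sup>2) = exp (\<epsilon> * x\<^sup>2)"
          by (simp flip: exp_add)
        also have "D * (1 + 2 / \<epsilon>) * exp (\<epsilon> * x\<^sup>2) * exp (- x\<^sup>2 / 2) \<le> K * exp (\<epsilon> * x\<^sup>2) * exp (- x\<^sup>2 / 2)"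
          using C(1) by (intro mult_right_mono) (auto simp: K_def)
        finally show ?thesis .
      qed
      then show "p n x \<le> sqrt (2 * pi) * K * exp (\<epsilon> * x\<^sup>2) * std_normal_density x"
        by (simp add: std_normal_density_def)
    qed
  qed
  then show ?thesis by blast
qed

end

section \<open>Pointwise convergence of the densities\<close>

lemma (in prob_space) indep_vars_shift:
  assumes "indep_vars (\<lambda>_. N) X {1..}"
  shows "indep_vars (\<lambda>_. N) (\<lambda>i. X (Suc i)) UNIV"
proof -
  let ?F = "\<lambda>i. {X i -` B \<inter> space M | B. B \<in> sets N}"
  have rv: "random_variable N (X (Suc i))" for i
    using assms by (auto simp: indep_vars_def2)
  have F: "indep_sets ?F {1..}" using assms by (simp add: indep_vars_def2)
  have "indep_sets (\<lambda>i. ?F (Suc i)) UNIV"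
  proof (rule indep_setsI)
    show "?F (Suc i) \<subseteq> events" for i using rv[of i] by (auto intro: measurable_sets)
    fix B and J :: "nat set"
    assume J: "J \<noteq> {}" "finite J" and B: "\<forall>j\<in>J. B j \<in> ?F (Suc j)"
    have "prob (\<Inter>j\<in>Suc ` J. B (j - 1)) = (\<Prod>j\<in>Suc ` J. prob (B (j - 1)))"
      using J B by (intro indep_setsD[OF F]) auto
    then show "prob (\<Inter>j\<in>J. B j) = (\<Prod>j\<in>J. prob (B j))"
      by (simp add: prod.reindex)
  qed
  then show ?thesis using rv by (simp add: indep_vars_def2)
qed

context renyi_sums
begin

lemma char_sum_law: "char (sum_law n) t = char \<nu> (t / sqrt (real n)) ^ n"
  using char_tilt_sum_law[of 0 n t] exp_int[of 0]
  by (simp add: nu.tilt_0 real_distribution.tilt_0[OF real_distribution_sum_law])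

lemma char_sum_law_tendsto: "(\<lambda>n. char (sum_law n) t) \<longlonglongrightarrow> of_real (exp (- t\<^sup>2 / 2))"
proof -
  let ?X = "\<lambda>i. Xs (Suc i)"
  have d: "distr M borel (?X i) = \<nu>" for i using law by simp
  have m[measurable]: "?X i \<in> borel_measurable M" for i using Xs_measurable by simp
  have E: "expectation (\<lambda>\<omega>. f (?X i \<omega>)) = (LINT x|\<nu>. f x)" if "f \<in> borel_measurable borel" for f :: "real \<Rightarrow> real" and i
    unfolding d[of i, symmetric] using that by (subst integral_distr) auto
  have mean: "expectation (?X i) = 0" for i using E[of "\<lambda>x. x" i] mean_zero by simp
  have "weak_conv_m (\<lambda>n. distr M borel (\<lambda>x. (\<Sum>i<n. ?X i x) / sqrt (real n * 1\<^sup>2))) std_normal_distribution"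
  proof (rule central_limit_theorem_zero_mean[where \<mu>=\<nu>])
    show "indep_vars (\<lambda>i. borel) ?X UNIV"
      by (rule indep_vars_shift[OF indep])
    show "integrable M (\<lambda>x. (?X n x)\<^sup>2)" for n
      using var_int unfolding d[of n, symmetric] by (subst (asm) integrable_distr_eq) auto
    show "variance (?X n) = 1\<^sup>2" for n
      using E[of "\<lambda>x. x\<^sup>2" n] var_one mean by simp
  qed (use d mean in auto)
  moreover have "distr M borel (\<lambda>x. (\<Sum>i<n. ?X i x) / sqrt (real n * 1\<^sup>2)) = sum_law n" for n
  proof -
    have "(\<Sum>i<n. ?X i x) = (\<Sum>i=1..n. Xs i x)" for x
      by (rule sum.reindex_bij_witness[where i="\<lambda>i. i - 1" and j=Suc]) auto
    then show ?thesis unfolding sum_law_def by (simp add: normalized_sum_def[abs_def])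
  qed
  ultimately have "weak_conv_m sum_law std_normal_distribution" by simp
  then have "(\<lambda>n. char (sum_law n) t) \<longlonglongrightarrow> char std_normal_distribution t"
    using real_distribution_sum_law real_dist_normal_dist by (intro levy_continuity1)
  then show ?thesis by (simp add: char_std_normal_distribution)
qed

lemma integrable_exp_neg_square: "a > 0 \<Longrightarrow> integrable lborel (\<lambda>t::real. exp (- (a * t\<^sup>2)))"
  by (rule integrableI_bounded) (auto simp: nn_integral_exp_neg_square)

lemma char_sum_law_measurable [measurable]: "char (sum_law n) \<in> borel_measurable borel"
  using real_distribution_sum_law by (rule real_distribution.char_measurable)

text \<open>
  Pointwise convergence is the central limit theorem. In place of an integrable majorant there is a
  fixed Gaussian plus remainders \<open>r n\<close> whose integrals are \<open>O(1 / sqrt n)\<close>. Dominated convergence applies to the part of the difference below the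
  Gaussian.
\<close>

lemma char_sum_law_L1_limit:
  "\<exists>\<delta>. \<delta> \<longlonglongrightarrow> (0::real) \<and> (\<forall>n\<ge>2 * n0. integrable lborel (char (sum_law n)) \<and>
     (LINT t|lborel. norm (char (sum_law n) t - of_real (exp (- t\<^sup>2 / 2)))) \<le> \<delta> n)"
proof -
  obtain c where c: "c > 0" and gap: "\<And>y t. \<bar>y\<bar> \<le> 1 \<Longrightarrow> norm (char (tilt \<nu> y) t) \<le> 1 - c * min 1 (t\<^sup>2)"
    using char_tilt_gap by blast
  have gap0: "norm (char \<nu> t) \<le> 1 - c * min 1 (t\<^sup>2)" for t
    using gap[of 0 t] by (simp add: nu.tilt_0)
  have [measurable]: "char \<nu> \<in> borel_measurable borel" by auto
  define J where "J = 2 * pi * A * exp (2 * real n0)"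
  have J: "J \<ge> 0" using A by (simp add: J_def)
  have Jle: "(\<integral>\<^sup>+t. ennreal (norm (char \<nu> t) ^ (2 * n0)) \<partial>lborel) \<le> ennreal J"
    using char_power_integral_unit[of 0] by (simp add: nu.tilt_0 J_def)
  let ?G = "\<lambda>t. exp (- (c * t\<^sup>2))" and ?N = "\<lambda>t::real. exp (- (1/2 * t\<^sup>2))"
  define r where "r n t = exp (- (c * real (n - 2 * n0))) * norm (char \<nu> (t / sqrt (real n))) ^ (2 * n0)" for n t
  have [measurable]: "r n \<in> borel_measurable borel" for n unfolding r_def by measurable
  have r0: "r n t \<ge> 0" for n t by (simp add: r_def)
  define K where "K = exp (2 * c * real n0) / c * J"
  have char_le: "norm (char (sum_law n) t) \<le> ?G t + r n t" if n: "n \<ge> 2 * n0" for n t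
  proof -
    have "real n * (t / sqrt (real n))\<^sup>2 = t\<^sup>2" using n n0 by (simp add: power_divide)
    then have "c * real n * (t / sqrt (real n))\<^sup>2 = c * t\<^sup>2" by (simp only: mult.assoc)
    moreover have "norm (char \<nu> (t / sqrt (real n))) ^ n
        \<le> exp (- (c * real n * (t / sqrt (real n))\<^sup>2)) + r n t"
      unfolding r_def using n c gap0 nu.cmod_char_le_1 by (intro power_le_gauss_plus_tail) auto
    ultimately show ?thesis by (simp only: char_sum_law norm_power)
  qed
  have r_nn: "(\<integral>\<^sup>+t. ennreal (r n t) \<partial>lborel) \<le> ennreal (K / sqrt (real n))" if n: "n \<ge> 2 * n0" for n
  proof -
    have n1: "real n \<ge> 1" using n n0 by simp
    have "(\<integral>\<^sup>+t. ennreal (r n t) \<partial>lborel) = \<bar>sqrt (real n)\<bar> * (\<integral>\<^sup>+t. ennreal (r n (0 + sqrt (real n) * t)) \<partial>lborel)"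
      using n1 by (intro nn_integral_real_affine) auto
    also have "(\<lambda>t. ennreal (r n (0 + sqrt (real n) * t)))
        = (\<lambda>t. ennreal (exp (- (c * real (n - 2 * n0)))) * ennreal (norm (char \<nu> t) ^ (2 * n0)))"
      using n1 by (auto simp: r_def fun_eq_iff simp flip: ennreal_mult)
    also have "(\<integral>\<^sup>+t. ennreal (exp (- (c * real (n - 2 * n0)))) * ennreal (norm (char \<nu> t) ^ (2 * n0)) \<partial>lborel)
       = ennreal (exp (- (c * real (n - 2 * n0)))) * (\<integral>\<^sup>+t. ennreal (norm (char \<nu> t) ^ (2 * n0)) \<partial>lborel)"
      by (rule nn_integral_cmult) measurable
    also have "\<dots> \<le> ennreal (exp (2 * c * real n0) / (c * real n)) * ennreal J"
      using exp_decay_le[OF c n] Jle by (intro mult_mono ennreal_leI) auto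
    also have "ennreal \<bar>sqrt (real n)\<bar> * (ennreal (exp (2 * c * real n0) / (c * real n)) * ennreal J)
        = ennreal (sqrt (real n) * (exp (2 * c * real n0) / (c * real n) * J))"
      using J c n1 by (simp flip: ennreal_mult)
    also have "sqrt (real n) * (exp (2 * c * real n0) / (c * real n) * J) = K / (real n / sqrt (real n))"
      using c n1 by (simp add: K_def field_simps)
    also have "real n / sqrt (real n) = sqrt (real n)" by (rule real_div_sqrt) simp
    finally show ?thesis by (simp add: mult_left_mono)
  qed
  have K: "K \<ge> 0" using J c by (simp add: K_def)
  have r_int: "integrable lborel (r n)" and r_le: "(LINT t|lborel. r n t) \<le> K / sqrt (real n)" if n: "n \<ge> 2 * n0" for n
  proof -
    show i: "integrable lborel (r n)"
      using r_nn[OF n] r0 by (intro integrableI_bounded) (auto intro: le_less_trans)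
    show "(LINT t|lborel. r n t) \<le> K / sqrt (real n)"
      using r_nn[OF n] nn_integral_eq_integral[OF i] r0 K by (simp add: ennreal_le_iff)
  qed
  \<comment> \<open>The part of the difference that lies below the integrable majorant.\<close>
  define h where "h n t = min (norm (char (sum_law n) t - of_real (?N t))) (?G t + ?N t)" for n t
  have [measurable]: "h n \<in> borel_measurable borel" for n unfolding h_def by measurable
  have GN: "integrable lborel (\<lambda>t. ?G t + ?N t)"
    using c by (intro Bochner_Integration.integrable_add integrable_exp_neg_square) auto
  have h_bound: "norm (h n t) \<le> ?G t + ?N t" for n t
    by (simp add: h_def)
  have h_int: "integrable lborel (h n)" for n
    by (rule Bochner_Integration.integrable_bound[OF GN]) (auto simp: h_def)
  have "(\<lambda>n. LINT t|lborel. h n t) \<longlonglongrightarrow> (LINT t|(lborel :: real measure). 0)"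
  proof (rule integral_dominated_convergence[where w="\<lambda>t. ?G t + ?N t"])
    show "integrable lborel (\<lambda>t. ?G t + ?N t)" by (rule GN)
    show "AE t in lborel. (\<lambda>n. h n t) \<longlonglongrightarrow> 0"
    proof (rule AE_I2)
      fix t
      have "(\<lambda>n. char (sum_law n) t - of_real (?N t)) \<longlonglongrightarrow> 0"
        using char_sum_law_tendsto[of t] by (intro LIM_zero) simp
      then have "(\<lambda>n. norm (char (sum_law n) t - of_real (?N t))) \<longlonglongrightarrow> 0"
        by (rule tendsto_norm_zero)
      then show "(\<lambda>n. h n t) \<longlonglongrightarrow> 0"
        by (rule tendsto_sandwich[OF _ _ tendsto_const, rotated 2]) (auto simp: h_def add_nonneg_nonneg)
    qed
  qed (use h_bound in auto)
  then have h_lim: "(\<lambda>n. LINT t|lborel. h n t) \<longlonglongrightarrow> 0" by simp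
  have "(\<lambda>n. K / sqrt (real n)) \<longlonglongrightarrow> 0"
    by (rule tendsto_divide_0[OF tendsto_const filterlim_at_top_imp_at_infinity[OF
          filterlim_compose[OF sqrt_at_top filterlim_real_sequentially]]])
  from tendsto_add[OF h_lim this] have "(\<lambda>n. (LINT t|lborel. h n t) + K / sqrt (real n)) \<longlonglongrightarrow> 0" by simp
  moreover have "integrable lborel (char (sum_law n))"
     "(LINT t|lborel. norm (char (sum_law n) t - of_real (exp (- t\<^sup>2 / 2)))) \<le> (LINT t|lborel. h n t) + K / sqrt (real n)"
    if n: "n \<ge> 2 * n0" for n
  proof -
    have "integrable lborel (\<lambda>t. ?G t + r n t)"
      using c r_int[OF n] integrable_exp_neg_square by auto
    then show ci: "integrable lborel (char (sum_law n))"
      by (rule Bochner_Integration.integrable_bound) (use char_le[OF n] r0 in \<open>auto simp: add_nonneg_nonneg\<close>)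
    have le: "norm (char (sum_law n) t - of_real (?N t)) \<le> h n t + r n t" for t
    proof -
      have "norm (char (sum_law n) t - of_real (?N t)) \<le> norm (char (sum_law n) t) + norm (of_real (?N t) :: complex)"
        by (rule norm_triangle_ineq4)
      also have "norm (of_real (?N t) :: complex) = ?N t" by simp
      finally show ?thesis using char_le[OF n, of t] r0[of n t] unfolding h_def min_def by auto
    qed
    have Nint: "integrable lborel (\<lambda>t. of_real (?N t) :: complex)"
      using integrable_exp_neg_square[of "1/2"] by (intro integrable_of_real) auto
    have "(LINT t|lborel. norm (char (sum_law n) t - of_real (?N t))) \<le> (LINT t|lborel. h n t + r n t)"
      using le ci Nint h_int r_int[OF n] by (intro integral_mono integrable_norm Bochner_Integration.integrable_diff Bochner_Integration.integrable_add) auto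
    also have "\<dots> = (LINT t|lborel. h n t) + (LINT t|lborel. r n t)"
      using h_int r_int[OF n] by (rule Bochner_Integration.integral_add)
    also have "\<dots> \<le> (LINT t|lborel. h n t) + K / sqrt (real n)"
      using r_le[OF n] by simp
    finally show "(LINT t|lborel. norm (char (sum_law n) t - of_real (exp (- t\<^sup>2 / 2)))) \<le> (LINT t|lborel. h n t) + K / sqrt (real n)"
      by simp
  qed
  ultimately show ?thesis by blast
qed

text \<open>
  Inversion bounds the difference of two densities, almost everywhere and uniformly, by the \<open>L\<^sup>1\<close> distance of
  their characteristic functions.
\<close>

lemma density_tendsto_normal:
  assumes dens: "\<forall>\<^sub>F n in sequentially. has_density M (normalized_sum Xs n) (p n)"
  shows "AE x in lborel. (\<lambda>n. p n x) \<longlonglongrightarrow> std_normal_density x"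
proof -
  obtain \<delta> where \<delta>: "\<delta> \<longlonglongrightarrow> 0" and ci: "\<And>n. n \<ge> 2 * n0 \<Longrightarrow> integrable lborel (char (sum_law n))"
    and L1: "\<And>n. n \<ge> 2 * n0 \<Longrightarrow> (LINT t|lborel. norm (char (sum_law n) t - of_real (exp (- t\<^sup>2 / 2)))) \<le> \<delta> n"
    using char_sum_law_L1_limit by blast
  obtain N where N: "\<And>n. n \<ge> N \<Longrightarrow> has_density M (normalized_sum Xs n) (p n)"
    using dens unfolding eventually_sequentially by blast
  have gi: "integrable lborel (\<lambda>t. complex_of_real (exp (- t\<^sup>2 / 2)))"
    using integrable_exp_neg_square[of "1/2"] by (intro integrable_of_real) auto
  have normal: "AE x in lborel. std_normal_density x = Re (CLINT t|lborel. iexp (- (t * x)) * of_real (exp (- t\<^sup>2 / 2))) / (2 * pi)"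
  proof -
    have "AE x in lborel. std_normal_density x = Re (CLINT t|lborel. iexp (- (t * x)) * char std_normal_distribution t) / (2 * pi)"
      using gi real_dist_normal_dist by (intro fourier_inversion_AE) (auto simp: char_std_normal_distribution)
    then show ?thesis by (simp add: char_std_normal_distribution)
  qed
  have "AE x in lborel. \<bar>p n x - std_normal_density x\<bar> \<le> \<delta> n" if n: "n \<ge> max N (2 * n0)" for n
  proof -
    have d: "has_density M (normalized_sum Xs n) (p n)" using N n by simp
    note q = sum_law_density[OF d]
    have ci': "integrable lborel (char (sum_law n))" using ci n by simp
    have "AE x in lborel. p n x = Re (CLINT t|lborel. iexp (- (t * x)) * char (sum_law n) t) / (2 * pi)"
      unfolding q(3) using q(1,2) ci' real_distribution_sum_law[of n]
      by (intro fourier_inversion_AE) (auto simp: q(3))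
    then show ?thesis using normal
    proof eventually_elim
      fix x
      assume 1: "p n x = Re (CLINT t|lborel. iexp (- (t * x)) * char (sum_law n) t) / (2 * pi)"
        and 2: "std_normal_density x = Re (CLINT t|lborel. iexp (- (t * x)) * of_real (exp (- t\<^sup>2 / 2))) / (2 * pi)"
      have rot: "integrable lborel (\<lambda>t. iexp (- (t * x)) * f t)" if "integrable lborel f" for f :: "real \<Rightarrow> complex"
        by (rule Bochner_Integration.integrable_bound[OF that])
           (use that in \<open>auto simp: norm_mult simp del: of_real_mult of_real_minus\<close>)
      let ?d = "\<lambda>t. char (sum_law n) t - of_real (exp (- t\<^sup>2 / 2))"
      have "p n x - std_normal_density x = Re (CLINT t|lborel. iexp (- (t * x)) * ?d t) / (2 * pi)"
        unfolding 1 2 right_diff_distrib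
        by (subst Bochner_Integration.integral_diff[OF rot[OF ci'] rot[OF gi]]) (simp add: diff_divide_distrib)
      then have "\<bar>p n x - std_normal_density x\<bar> = \<bar>Re (CLINT t|lborel. iexp (- (t * x)) * ?d t)\<bar> / (2 * pi)"
        by simp
      also have "\<dots> \<le> (LINT t|lborel. norm (?d t)) / (2 * pi)"
      proof (rule divide_right_mono)
        have "\<bar>Re (CLINT t|lborel. iexp (- (t * x)) * ?d t)\<bar> \<le> norm (CLINT t|lborel. iexp (- (t * x)) * ?d t)"
          by (rule abs_Re_le_cmod)
        also have "\<dots> \<le> (LINT t|lborel. norm (iexp (- (t * x)) * ?d t))" by (rule integral_norm_bound)
        also have "\<dots> = (LINT t|lborel. norm (?d t))"
          by (simp only: norm_mult norm_exp_i_times mult_1)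
        finally show "\<bar>Re (CLINT t|lborel. iexp (- (t * x)) * ?d t)\<bar> \<le> (LINT t|lborel. norm (?d t))" .
      qed simp
      also have "\<dots> \<le> (LINT t|lborel. norm (?d t)) / 1"
        using pi_ge_two by (intro divide_left_mono integral_nonneg_AE) auto
      also have "\<dots> \<le> \<delta> n" using L1[of n] n by simp
      finally show "\<bar>p n x - std_normal_density x\<bar> \<le> \<delta> n" .
    qed
  qed
  then have "AE x in lborel. \<forall>n. n \<ge> max N (2 * n0) \<longrightarrow> \<bar>p n x - std_normal_density x\<bar> \<le> \<delta> n"
    by (subst AE_all_countable) auto
  then show ?thesis
  proof eventually_elim
    fix x assume b: "\<forall>n. n \<ge> max N (2 * n0) \<longrightarrow> \<bar>p n x - std_normal_density x\<bar> \<le> \<delta> n"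
    have "(\<lambda>n. p n x - std_normal_density x) \<longlonglongrightarrow> 0"
      by (rule Lim_null_comparison[OF eventually_sequentiallyI[of "max N (2 * n0)"] \<delta>]) (use b in auto)
    then show "(\<lambda>n. p n x) \<longlonglongrightarrow> std_normal_density x" by (rule LIM_zero_cancel)
  qed
qed

end

section \<open>Convergence of the divergences\<close>

lemma ln_ennreal_tendsto_0:
  assumes "T \<longlonglongrightarrow> (1::ennreal)"
  shows "(\<lambda>n. ln_ennreal (T n)) \<longlonglongrightarrow> 0"
proof -
  have "(\<lambda>n. enn2real (T n)) \<longlonglongrightarrow> 1"
    using tendsto_enn2real[of T 1 sequentially] assms by simp
  then have "(\<lambda>n. ln (enn2real (T n))) \<longlonglongrightarrow> ln 1"
    by (intro tendsto_ln) auto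
  then have "(\<lambda>n. ereal (ln (enn2real (T n)))) \<longlonglongrightarrow> 0"
    by (simp add: zero_ereal_def)
  moreover have "\<forall>\<^sub>F n in sequentially. ereal (ln (enn2real (T n))) = ln_ennreal (T n)"
  proof -
    have "\<forall>\<^sub>F n in sequentially. 0 < T n" "\<forall>\<^sub>F n in sequentially. T n < 2"
      using assms by (auto intro: order_tendstoD)
    then show ?thesis
      by eventually_elim (auto simp: ln_ennreal_def dest: less_trans[of _ 2 \<top>])
  qed
  ultimately show ?thesis by (rule Lim_transform_eventually)
qed

lemma abs_mult_ln_le: "0 \<le> u \<Longrightarrow> \<bar>u * ln u\<bar> \<le> 1 + u\<^sup>2" for u :: real
proof -
  assume u: "0 \<le> u"
  consider "u = 0" | "0 < u" "u < 1" | "u \<ge> 1" using u by linarith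
  then show ?thesis
  proof cases
    case 2
    have "- ln u = ln (1 / u)" using 2 by (simp add: ln_div)
    also have "\<dots> \<le> 1 / u - 1" using 2 by (intro ln_le_minus_one) auto
    finally have "u * (- ln u) \<le> u * (1 / u - 1)" using 2 by (intro mult_left_mono) auto
    also have "\<dots> \<le> 1" using 2 by (simp add: algebra_simps)
    finally have "- (u * ln u) \<le> 1" by simp
    moreover have "u * ln u \<le> 0" using 2 by (simp add: mult_nonneg_nonpos)
    ultimately show ?thesis using zero_le_power2[of u] by linarith
  next
    case 3
    have "u * ln u \<le> u * u" using 3 ln_le_minus_one[of u] by (intro mult_left_mono) auto
    moreover have "0 \<le> u * ln u" using 3 by simp
    ultimately show ?thesis by (simp add: power2_eq_square)
  qed simp
qed

text \<open>
  With \<open>u = p / \<phi>\<close>, both \<open>u powr \<alpha> \<phi>\<close> and \<open>u ln u \<phi>\<close> are dominated once \<open>u\<close> is at most a multiple of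
  \<open>exp (\<epsilon> x\<^sup>2)\<close> with \<open>\<epsilon> max \<alpha> 2 \<le> 1/4\<close>: the dominating function \<open>exp (x\<^sup>2 / 4) \<phi>\<close> is integrable. For the
  entropy the exponent \<open>2\<close> is used, because \<open>|u ln u| \<le> 1 + u\<^sup>2\<close>.
\<close>

lemma renyi_divergence_tendsto_0:
  fixes p :: "nat \<Rightarrow> real \<Rightarrow> real"
  assumes meas: "\<forall>\<^sub>F n in sequentially. p n \<in> borel_measurable borel \<and> (\<forall>x. 0 \<le> p n x)"
    and dom: "\<And>\<epsilon>. \<epsilon> > 0 \<Longrightarrow> \<exists>K. \<forall>\<^sub>F n in sequentially. AE x in lborel. p n x \<le> K * exp (\<epsilon> * x\<^sup>2) * std_normal_density x"
    and lim: "AE x in lborel. (\<lambda>n. p n x) \<longlonglongrightarrow> std_normal_density x"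
    and \<alpha>: "\<alpha> > 0"
  shows "(\<lambda>n. renyi_divergence_normal \<alpha> (p n)) \<longlonglongrightarrow> 0"
proof -
  let ?\<phi> = std_normal_density
  have \<phi>: "?\<phi> x > 0" for x by (simp add: normal_density_pos)
  define \<epsilon> where "\<epsilon> = 1 / (4 * max \<alpha> 2)"
  have \<epsilon>: "\<epsilon> > 0" by (simp add: \<epsilon>_def)
  obtain K N where N: "\<And>n. n \<ge> N \<Longrightarrow> p n \<in> borel_measurable borel" "\<And>n x. n \<ge> N \<Longrightarrow> 0 \<le> p n x"
      and bound: "\<And>n. n \<ge> N \<Longrightarrow> AE x in lborel. p n x \<le> K * exp (\<epsilon> * x\<^sup>2) * ?\<phi> x"
  proof -
    obtain K where "\<forall>\<^sub>F n in sequentially. AE x in lborel. p n x \<le> K * exp (\<epsilon> * x\<^sup>2) * ?\<phi> x"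
      using dom[OF \<epsilon>] by blast
    with meas have "\<forall>\<^sub>F n in sequentially. (p n \<in> borel_measurable borel \<and> (\<forall>x. 0 \<le> p n x)) \<and> (AE x in lborel. p n x \<le> K * exp (\<epsilon> * x\<^sup>2) * ?\<phi> x)"
      by (rule eventually_conj)
    then show ?thesis using that unfolding eventually_sequentially by blast
  qed
  \<comment> \<open>Dominated convergence requires its bounds at every index, hence the shift by \<open>N\<close>.\<close>
  define q where "q n = p (n + N)" for n
  define u where "u n x = q n x / ?\<phi> x" for n x
  have qm[measurable]: "q n \<in> borel_measurable borel" for n by (simp add: q_def N)
  have [measurable]: "u n \<in> borel_measurable borel" for n unfolding u_def by measurable
  have q0: "0 \<le> q n x" for n x by (simp add: q_def N)
  have u0: "0 \<le> u n x" for n x using q0[of n x] \<phi>[of x] by (simp add: u_def)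
  have qu: "q n x = u n x * ?\<phi> x" for n x using \<phi>[of x] by (simp add: u_def)
  have u_lim: "AE x in lborel. (\<lambda>n. u n x) \<longlonglongrightarrow> 1"
    using lim
  proof eventually_elim
    fix x assume "(\<lambda>n. p n x) \<longlonglongrightarrow> ?\<phi> x"
    then have "(\<lambda>n. q n x) \<longlonglongrightarrow> ?\<phi> x" unfolding q_def by (rule LIMSEQ_ignore_initial_segment)
    then have "(\<lambda>n. u n x) \<longlonglongrightarrow> ?\<phi> x / ?\<phi> x"
      unfolding u_def using \<phi>[of x] by (intro tendsto_divide tendsto_const) auto
    then show "(\<lambda>n. u n x) \<longlonglongrightarrow> 1" using \<phi>[of x] by simp
  qed
  have u_bound: "AE x in lborel. u n x \<le> \<bar>K\<bar> * exp (\<epsilon> * x\<^sup>2)" for n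
    using bound[of "n + N", folded q_def, simplified]
  proof eventually_elim
    fix x assume "q n x \<le> K * exp (\<epsilon> * x\<^sup>2) * ?\<phi> x"
    then have "u n x \<le> K * exp (\<epsilon> * x\<^sup>2)" using \<phi>[of x] by (simp add: u_def divide_le_eq)
    also have "\<dots> \<le> \<bar>K\<bar> * exp (\<epsilon> * x\<^sup>2)" by (intro mult_right_mono) auto
    finally show "u n x \<le> \<bar>K\<bar> * exp (\<epsilon> * x\<^sup>2)" .
  qed
  have gauss_fin: "(\<integral>\<^sup>+x. ennreal (c * exp (1/4 * x\<^sup>2) * ?\<phi> x) \<partial>lborel) < \<infinity>" if "c \<ge> 0" for c :: real
  proof -
    have "(\<integral>\<^sup>+x. ennreal (c * exp (1/4 * x\<^sup>2) * ?\<phi> x) \<partial>lborel)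
        = (\<integral>\<^sup>+x. ennreal (c / sqrt (2 * pi)) * ennreal (exp (- (1/4 * x\<^sup>2))) \<partial>lborel)"
    proof (rule nn_integral_cong)
      fix x :: real
      have "exp (1/4 * x\<^sup>2) * exp (- x\<^sup>2 / 2) = exp (- (1/4 * x\<^sup>2))"
        by (simp flip: exp_add)
      then have eq: "c * exp (1/4 * x\<^sup>2) * ?\<phi> x = c / sqrt (2 * pi) * exp (- (1/4 * x\<^sup>2))"
        unfolding std_normal_density_def by (simp add: ac_simps)
      show "ennreal (c * exp (1/4 * x\<^sup>2) * ?\<phi> x) = ennreal (c / sqrt (2 * pi)) * ennreal (exp (- (1/4 * x\<^sup>2)))"
        unfolding eq by (rule ennreal_mult) (use that in auto)
    qed
    also have "\<dots> = ennreal (c / sqrt (2 * pi)) * ennreal (sqrt (pi / (1/4)))"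
      using nn_integral_exp_neg_square[of "1/4"] by (subst nn_integral_cmult) auto
    also have "\<dots> < \<infinity>" by (simp add: ennreal_mult_less_top)
    finally show ?thesis .
  qed
  have exp_pow: "exp (\<epsilon> * x\<^sup>2) powr s \<le> exp (1/4 * x\<^sup>2)" if "0 \<le> s" "s \<le> max \<alpha> 2" for s x
  proof -
    have "\<epsilon> * s \<le> 1/4" using that by (simp add: \<epsilon>_def field_simps)
    then have "x\<^sup>2 * (\<epsilon> * s) \<le> x\<^sup>2 * (1/4)" by (intro mult_left_mono) auto
    then show ?thesis by (simp add: exp_powr_real ac_simps)
  qed
  have "(\<lambda>n. renyi_divergence_normal \<alpha> (q n)) \<longlonglongrightarrow> 0"
  proof (cases "\<alpha> = 1")
    case False
    have "(\<lambda>n. \<integral>\<^sup>+x. ennreal (u n x powr \<alpha> * ?\<phi> x) \<partial>lborel) \<longlonglongrightarrow> (\<integral>\<^sup>+x. ennreal (?\<phi> x) \<partial>lborel)"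
    proof (rule nn_integral_dominated_convergence[where w="\<lambda>x. ennreal (\<bar>K\<bar> powr \<alpha> * exp (1/4 * x\<^sup>2) * ?\<phi> x)"])
      show "(\<integral>\<^sup>+x. ennreal (\<bar>K\<bar> powr \<alpha> * exp (1/4 * x\<^sup>2) * ?\<phi> x) \<partial>lborel) < \<infinity>"
        by (rule gauss_fin) simp
      show "AE x in lborel. ennreal (u n x powr \<alpha> * ?\<phi> x) \<le> ennreal (\<bar>K\<bar> powr \<alpha> * exp (1/4 * x\<^sup>2) * ?\<phi> x)" for n
        using u_bound[of n]
      proof eventually_elim
        fix x assume "u n x \<le> \<bar>K\<bar> * exp (\<epsilon> * x\<^sup>2)"
        then have "u n x powr \<alpha> \<le> (\<bar>K\<bar> * exp (\<epsilon> * x\<^sup>2)) powr \<alpha>"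
          using u0 \<alpha> by (intro powr_mono2) auto
        also have "\<dots> = \<bar>K\<bar> powr \<alpha> * exp (\<epsilon> * x\<^sup>2) powr \<alpha>" by (simp add: powr_mult)
        also have "\<dots> \<le> \<bar>K\<bar> powr \<alpha> * exp (1/4 * x\<^sup>2)"
          using \<alpha> by (intro mult_left_mono exp_pow) auto
        finally show "ennreal (u n x powr \<alpha> * ?\<phi> x) \<le> ennreal (\<bar>K\<bar> powr \<alpha> * exp (1/4 * x\<^sup>2) * ?\<phi> x)"
          by (intro ennreal_leI mult_right_mono) auto
      qed
      show "AE x in lborel. (\<lambda>n. ennreal (u n x powr \<alpha> * ?\<phi> x)) \<longlonglongrightarrow> ennreal (?\<phi> x)"
        using u_lim
      proof eventually_elim
        fix x assume "(\<lambda>n. u n x) \<longlonglongrightarrow> 1"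
        then have "(\<lambda>n. u n x powr \<alpha> * ?\<phi> x) \<longlonglongrightarrow> 1 powr \<alpha> * ?\<phi> x"
          by (intro tendsto_mult tendsto_powr tendsto_const) auto
        then show "(\<lambda>n. ennreal (u n x powr \<alpha> * ?\<phi> x)) \<longlonglongrightarrow> ennreal (?\<phi> x)"
          by (intro tendsto_ennrealI) simp
      qed
    qed auto
    also have "(\<integral>\<^sup>+x. ennreal (?\<phi> x) \<partial>lborel) = 1"
      by (subst nn_integral_eq_integral) auto
    finally have "(\<lambda>n. ln_ennreal (\<integral>\<^sup>+x. ennreal (u n x powr \<alpha> * ?\<phi> x) \<partial>lborel)) \<longlonglongrightarrow> 0"
      by (rule ln_ennreal_tendsto_0)
    then have "(\<lambda>n. ereal (1 / (\<alpha> - 1)) * ln_ennreal (\<integral>\<^sup>+x. ennreal (u n x powr \<alpha> * ?\<phi> x) \<partial>lborel)) \<longlonglongrightarrow> ereal (1 / (\<alpha> - 1)) * 0"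
      by (intro tendsto_cmult_ereal) auto
    then show ?thesis
      using False by (simp add: renyi_divergence_normal_def u_def)
  next
    case True
    define w where "w x = (1 + K\<^sup>2) * exp (1/4 * x\<^sup>2) * ?\<phi> x" for x
    have [measurable]: "w \<in> borel_measurable borel" unfolding w_def by measurable
    have w_fin: "(\<integral>\<^sup>+x. ennreal (w x) \<partial>lborel) < \<infinity>"
      unfolding w_def by (rule gauss_fin) (simp add: add_nonneg_nonneg)
    have ent_bound: "AE x in lborel. \<bar>q n x * ln (u n x)\<bar> \<le> w x" for n
      using u_bound[of n]
    proof eventually_elim
      fix x assume "u n x \<le> \<bar>K\<bar> * exp (\<epsilon> * x\<^sup>2)"
      then have "(u n x)\<^sup>2 \<le> (\<bar>K\<bar> * exp (\<epsilon> * x\<^sup>2))\<^sup>2" using u0 by (intro power_mono) auto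
      also have "\<dots> = K\<^sup>2 * exp (\<epsilon> * x\<^sup>2) powr 2" by (simp add: power_mult_distrib)
      also have "\<dots> \<le> K\<^sup>2 * exp (1/4 * x\<^sup>2)" by (intro mult_left_mono exp_pow) auto
      finally have "1 + (u n x)\<^sup>2 \<le> exp (1/4 * x\<^sup>2) + K\<^sup>2 * exp (1/4 * x\<^sup>2)"
        by (intro add_mono) auto
      then have "\<bar>u n x * ln (u n x)\<bar> \<le> (1 + K\<^sup>2) * exp (1/4 * x\<^sup>2)"
        using abs_mult_ln_le[OF u0[of n x]] by (simp add: distrib_right)
      then have "\<bar>u n x * ln (u n x)\<bar> * ?\<phi> x \<le> w x"
        unfolding w_def by (intro mult_right_mono) auto
      then show "\<bar>q n x * ln (u n x)\<bar> \<le> w x" by (simp add: qu abs_mult ac_simps)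
    qed
    have ent_lim: "AE x in lborel. (\<lambda>n. q n x * ln (u n x)) \<longlonglongrightarrow> 0"
      using u_lim
    proof eventually_elim
      fix x assume "(\<lambda>n. u n x) \<longlonglongrightarrow> 1"
      then have "(\<lambda>n. u n x * ?\<phi> x * ln (u n x)) \<longlonglongrightarrow> 1 * ?\<phi> x * ln 1"
        by (intro tendsto_mult tendsto_const tendsto_ln) auto
      then show "(\<lambda>n. q n x * ln (u n x)) \<longlonglongrightarrow> 0" by (simp add: qu)
    qed
    have part: "(\<lambda>n. \<integral>\<^sup>+x. ennreal (s * (q n x * ln (u n x))) \<partial>lborel) \<longlonglongrightarrow> 0" if s: "\<bar>s\<bar> = 1" for s :: real
    proof -
      have "(\<lambda>n. \<integral>\<^sup>+x. ennreal (s * (q n x * ln (u n x))) \<partial>lborel) \<longlonglongrightarrow> (\<integral>\<^sup>+x. 0 \<partial>(lborel :: real measure))"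
      proof (rule nn_integral_dominated_convergence[where w="\<lambda>x. ennreal (w x)"])
        show "AE x in lborel. ennreal (s * (q n x * ln (u n x))) \<le> ennreal (w x)" for n
          using ent_bound[of n]
        proof eventually_elim
          fix x assume "\<bar>q n x * ln (u n x)\<bar> \<le> w x"
          then have "\<bar>s * (q n x * ln (u n x))\<bar> \<le> w x" using s by (simp add: abs_mult)
          then show "ennreal (s * (q n x * ln (u n x))) \<le> ennreal (w x)" by (intro ennreal_leI) linarith
        qed
        show "AE x in lborel. (\<lambda>n. ennreal (s * (q n x * ln (u n x)))) \<longlonglongrightarrow> 0"
          using ent_lim
        proof eventually_elim
          fix x assume "(\<lambda>n. q n x * ln (u n x)) \<longlonglongrightarrow> 0"
          then have "(\<lambda>n. s * (q n x * ln (u n x))) \<longlonglongrightarrow> s * 0" by (rule tendsto_mult_left)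
          from tendsto_ennrealI[OF this] show "(\<lambda>n. ennreal (s * (q n x * ln (u n x)))) \<longlonglongrightarrow> 0" by simp
        qed
      qed (use w_fin in auto)
      then show ?thesis by simp
    qed
    have pos: "(\<lambda>n. enn2ereal (\<integral>\<^sup>+x. ennreal (q n x * ln (q n x / ?\<phi> x)) \<partial>lborel)) \<longlonglongrightarrow> 0"
      using tendsto_enn2erealI[OF part[of 1]] by (simp add: u_def zero_ennreal.rep_eq)
    have neg: "(\<lambda>n. enn2ereal (\<integral>\<^sup>+x. ennreal (- (q n x * ln (q n x / ?\<phi> x))) \<partial>lborel)) \<longlonglongrightarrow> 0"
      using tendsto_enn2erealI[OF part[of "-1"]] by (simp add: u_def zero_ennreal.rep_eq)
    have "(\<lambda>n. relative_entropy_normal (q n)) \<longlonglongrightarrow> 0 - 0"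
      unfolding relative_entropy_normal_def by (rule tendsto_diff_ereal[OF _ _ pos neg]) auto
    then show ?thesis using True by (simp add: renyi_divergence_normal_def)
  qed
  then show ?thesis unfolding q_def by (rule LIMSEQ_offset)
qed

lemma weighted_L2_finite_if_renyi_2_finite:
  assumes "renyi_divergence_normal 2 q < \<infinity>" and q0: "\<And>x. 0 \<le> q x"
  shows "\<exists>A\<ge>0. (\<integral>\<^sup>+x. ennreal ((q x)\<^sup>2 * exp (x\<^sup>2 / 2)) \<partial>lborel) \<le> ennreal A"
proof -
  let ?T = "\<integral>\<^sup>+x. ennreal ((q x / std_normal_density x) powr 2 * std_normal_density x) \<partial>lborel"
  have "?T \<noteq> \<infinity>"
    using assms by (auto simp: renyi_divergence_normal_def ln_ennreal_def)
  then obtain A where A: "A \<ge> 0" "?T = ennreal A" by (cases ?T) auto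
  have "(\<integral>\<^sup>+x. ennreal ((q x)\<^sup>2 * exp (x\<^sup>2 / 2)) \<partial>lborel) \<le> ?T"
  proof (intro nn_integral_mono ennreal_leI)
    fix x
    have \<phi>: "std_normal_density x > 0" by (simp add: normal_density_pos)
    have "(q x / std_normal_density x) powr 2 * std_normal_density x = (q x)\<^sup>2 / std_normal_density x"
      using \<phi> q0[of x] by (simp add: power2_eq_square)
    also have "\<dots> = sqrt (2 * pi) * ((q x)\<^sup>2 * exp (x\<^sup>2 / 2))"
      by (simp add: std_normal_density_def exp_minus field_simps)
    finally have eq: "(q x / std_normal_density x) powr 2 * std_normal_density x = sqrt (2 * pi) * ((q x)\<^sup>2 * exp (x\<^sup>2 / 2))" .
    have "1 * ((q x)\<^sup>2 * exp (x\<^sup>2 / 2)) \<le> sqrt (2 * pi) * ((q x)\<^sup>2 * exp (x\<^sup>2 / 2))"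
      using pi_ge_two by (intro mult_right_mono) auto
    then show "(q x)\<^sup>2 * exp (x\<^sup>2 / 2) \<le> (q x / std_normal_density x) powr 2 * std_normal_density x"
      unfolding eq by simp
  qed
  then show ?thesis using A by auto
qed

section \<open>The characterization\<close>

theorem theorem1p1:
  fixes N :: "'b measure" and X :: "'b \<Rightarrow> real"
    and M :: "'a measure" and Xs :: "nat \<Rightarrow> 'a \<Rightarrow> real"
    and p :: "nat \<Rightarrow> real \<Rightarrow> real"
  assumes "prob_space N" and "X \<in> borel_measurable N"
    and "integrable N X" and "integrable N (\<lambda>\<omega>. (X \<omega>)\<^sup>2)"
    and "prob_space.expectation N X = 0" and "prob_space.variance N X = 1"
    and "prob_space M"
    and "prob_space.indep_vars M (\<lambda>_. borel) Xs {1..}"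
    and "\<forall>i\<ge>1. distr M borel (Xs i) = distr N borel X"
    and "\<forall>\<^sub>F n in sequentially. has_density M (normalized_sum Xs n) (p n)"
    and "\<forall>\<alpha>>0. \<exists>n\<ge>1. has_density M (normalized_sum Xs n) (p n) \<and>
           renyi_divergence_normal \<alpha> (p n) < \<infinity>"
  shows "(\<forall>\<alpha>>0. (\<lambda>n. renyi_divergence_normal \<alpha> (p n)) \<longlonglongrightarrow> 0) \<longleftrightarrow> strictly_subgaussian N X"
proof -
  interpret N: prob_space N by fact
  note X[measurable] = assms(2)
  define \<nu> where "\<nu> = distr N borel X"
  interpret S: iid_sums M \<nu> Xs
    using assms(7,8,9) by (auto simp: iid_sums_def iid_sums_axioms_def \<nu>_def)
  have nn: "(\<integral>\<^sup>+x. ennreal (exp (t * x)) \<partial>\<nu>) = (\<integral>\<^sup>+\<omega>. ennreal (exp (t * X \<omega>)) \<partial>N)" for t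
    unfolding \<nu>_def by (subst nn_integral_distr) auto
  have var: "(LINT x|\<nu>. x\<^sup>2) = 1"
    using assms(5,6) unfolding \<nu>_def by (subst integral_distr) auto
  show ?thesis
  proof
    assume lim: "\<forall>\<alpha>>0. (\<lambda>n. renyi_divergence_normal \<alpha> (p n)) \<longlonglongrightarrow> 0"
    have "(\<integral>\<^sup>+\<omega>. ennreal (exp (t * X \<omega>)) \<partial>N) \<le> ennreal (exp (t\<^sup>2 / 2))" for t
      unfolding nn[symmetric] by (rule S.mgf_le_of_renyi_tendsto[OF assms(10)]) (use lim in auto)
    then show "strictly_subgaussian N X"
      using assms(2,4,6) by (simp add: strictly_subgaussian_def)
  next
    assume sub: "strictly_subgaussian N X"
    have L: "(\<integral>\<^sup>+x. ennreal (exp (t * x)) \<partial>\<nu>) \<le> ennreal (exp (t\<^sup>2 / 2))" for t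
      using sub assms(6) by (simp add: strictly_subgaussian_def nn)
    have int: "integrable \<nu> (\<lambda>x. exp (t * x))" for t
      using L[of t] by (intro integrableI_bounded) (auto intro: le_less_trans)
    obtain n0 where n0: "n0 \<ge> 1" "has_density M (normalized_sum Xs n0) (p n0)" "renyi_divergence_normal 2 (p n0) < \<infinity>"
      using assms(11) by (meson zero_less_numeral)
    obtain A where A: "A \<ge> 0" "(\<integral>\<^sup>+x. ennreal ((p n0 x)\<^sup>2 * exp (x\<^sup>2 / 2)) \<partial>lborel) \<le> ennreal A"
      using weighted_L2_finite_if_renyi_2_finite[OF n0(3) S.sum_law_density(2)[OF n0(2)]] by blast
    interpret R: renyi_sums M \<nu> Xs p n0 A
    proof unfold_locales
      show "mgf \<nu> h \<le> exp (h\<^sup>2 / 2)" for h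
        using L[of h] nn_integral_eq_integral[OF int[of h]] by (simp add: mgf_def ennreal_le_iff)
      show "integrable \<nu> (\<lambda>x. x)" "integrable \<nu> (\<lambda>x. x\<^sup>2)"
        using assms(3,4) unfolding \<nu>_def by (simp_all add: integrable_distr_eq)
      show "(LINT x|\<nu>. x) = 0"
        using assms(5) unfolding \<nu>_def by (subst integral_distr) auto
    qed (use int n0 A var in auto)
    show "\<forall>\<alpha>>0. (\<lambda>n. renyi_divergence_normal \<alpha> (p n)) \<longlonglongrightarrow> 0"
    proof (intro allI impI)
      fix \<alpha> :: real assume \<alpha>: "\<alpha> > 0"
      show "(\<lambda>n. renyi_divergence_normal \<alpha> (p n)) \<longlonglongrightarrow> 0"
      proof (rule renyi_divergence_tendsto_0[OF _ _ _ \<alpha>])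
        show "\<forall>\<^sub>F n in sequentially. p n \<in> borel_measurable borel \<and> (\<forall>x. 0 \<le> p n x)"
          using assms(10) by eventually_elim (blast dest: S.sum_law_density)
      qed (use R.density_domination[OF _ assms(10)] R.density_tendsto_normal[OF assms(10)] in auto)
    qed
  qed
qed

end
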